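(* The Haar probability measure $\mu_0$ of the compact group $X$ is of tree type.
   Context: $X$ is the set of families $x=(x_{k,l})_{(k,l)\in\mathbb Z^2}$ in $(\mathbb Z/2\mathbb Z)^{\mathbb Z^2}$ such that $x_{k,l}+x_{k+1,l}+x_{k,l+1}=0$ for all $(k,l)\in\mathbb Z^2$. It is a closed subgroup of the compact group $(\mathbb Z/2\mathbb Z)^{\mathbb Z^2}$ (product topology and product group law), and $\mathbb Z^2$ acts on it by group automorphisms through the commuting maps $T:(x_{k,l})\mapsto(x_{k+1,l})$ and $S:(x_{k,l})\mapsto(x_{k,l+1})$; $\mu_0$ is invariant and ergodic for this action. $Y=\{x\in X\mid x_{0,0}=1\}$. If $x\in Y$, exactly one of $Tx$, $Sx$ belongs to $Y$; it is denoted $\sigma(x)$, which defines $\sigma:Y\to Y$. For $x\in Y$, the $\sigma$-component of $x$ is the set of points $y\in Y$ of the $\mathbb Z^2$-orbit of $x$ for which there exist integers $p,q\ge 0$ with $\sigma^p(x)=\sigma^q(y)$. The $\sigma$-antecedents of $x\in Y$ are the elements of $\bigcup_{n\ge 1}\sigma^{-n}(x)$. $Z$ is the set of elements of $Y$ that have infinitely many $\sigma$-antecedents. An atomless, $\mathbb Z^2$-invariant and ergodic Borel probability measure $\mu$ on $X$ is said to be of tree type if $\mu(Z)=0$ and there exists a $\mathbb Z^2$-invariant Borel set $B\subset X$ with $\mu(B)=1$ such that, for every $x\in Y\cap B$, the $\sigma$-component of $x$ contains all the points of the $\mathbb Z^2$-orbit of $x$ that belong to $Y$. *)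

theory Defs
  imports "HOL-Probability.Probability" "HOL-Library.Z2"
begin

text \<open>
  \<open>\<int>/2\<int>\<close> is the type \<^typ>\<open>bit\<close>. With the discrete topology on it, the
  type \<^typ>\<open>int \<times> int \<Rightarrow> bit\<close> carries the product topology, and \<open>borel\<close>
  is the corresponding Borel sigma-algebra.
\<close>

instantiation bit :: discrete_topology
begin

definition open_bit :: "bit set \<Rightarrow> bool"
  where "open_bit U \<longleftrightarrow> True"

instance
  by standard (simp_all add: open_bit_def)

end

type_synonym config = "int \<times> int \<Rightarrow> bit"

definition spaceX :: "config set" where
  "spaceX = {x. \<forall>k l. x (k, l) + x (k + 1, l) + x (k, l + 1) = 0}"

definition borelX :: "config measure" where
  "borelX = restrict_space borel spaceX"

definition shiftT :: "config \<Rightarrow> config" where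
  "shiftT x = (\<lambda>(k, l). x (k + 1, l))"

definition shiftS :: "config \<Rightarrow> config" where
  "shiftS x = (\<lambda>(k, l). x (k, l + 1))"

text \<open>\<open>act (a, b)\<close> is \<open>T\<^sup>a S\<^sup>b\<close>, for all integers \<open>a\<close> and \<open>b\<close>.\<close>

definition act :: "int \<times> int \<Rightarrow> config \<Rightarrow> config" where
  "act v x = (\<lambda>(k, l). x (k + fst v, l + snd v))"

lemma shiftT_eq_act: "shiftT = act (1, 0)"
  by (simp add: fun_eq_iff shiftT_def act_def)

lemma shiftS_eq_act: "shiftS = act (0, 1)"
  by (simp add: fun_eq_iff shiftS_def act_def)

lemma act_zero: "act (0, 0) x = x"
  by (simp add: fun_eq_iff act_def)

lemma act_act: "act v (act w x) = act (fst v + fst w, snd v + snd w) x"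
  by (simp add: fun_eq_iff act_def algebra_simps)

lemma act_in_spaceX:
  assumes "x \<in> spaceX"
  shows "act v x \<in> spaceX"
proof -
  have "x (k + fst v, l + snd v) + x (k + fst v + 1, l + snd v)
      + x (k + fst v, l + snd v + 1) = 0" for k l
    using assms by (simp add: spaceX_def)
  then show ?thesis
    by (simp add: spaceX_def act_def add.assoc add.commute add.left_commute)
qed

definition orbit :: "config \<Rightarrow> config set" where
  "orbit x = range (\<lambda>v. act v x)"

definition borel_probability :: "config measure \<Rightarrow> bool" where
  "borel_probability \<mu> \<longleftrightarrow> prob_space \<mu> \<and> sets \<mu> = sets borelX"

text \<open>
  On the compact metrizable group \<open>X\<close> every Borel probability measure is regular, so
  translation invariance characterizes the Haar probability measure.
\<close>

definition haar_probability :: "config measure \<Rightarrow> bool" where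
  "haar_probability \<mu> \<longleftrightarrow> borel_probability \<mu> \<and>
     (\<forall>a\<in>spaceX. distr \<mu> \<mu> (\<lambda>x i. a i + x i) = \<mu>)"

definition invariant_measure :: "config measure \<Rightarrow> bool" where
  "invariant_measure \<mu> \<longleftrightarrow> (\<forall>v. distr \<mu> \<mu> (act v) = \<mu>)"

definition invariant_set :: "config set \<Rightarrow> bool" where
  "invariant_set B \<longleftrightarrow> (\<forall>v. act v ` B = B)"

definition ergodic_measure :: "config measure \<Rightarrow> bool" where
  "ergodic_measure \<mu> \<longleftrightarrow>
     (\<forall>B\<in>sets \<mu>. invariant_set B \<longrightarrow> emeasure \<mu> B = 0 \<or> emeasure \<mu> B = 1)"

definition atom_of :: "config measure \<Rightarrow> config set \<Rightarrow> bool" where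
  "atom_of \<mu> A \<longleftrightarrow> A \<in> sets \<mu> \<and> emeasure \<mu> A > 0 \<and>
     (\<forall>C\<in>sets \<mu>. C \<subseteq> A \<longrightarrow> emeasure \<mu> C = 0 \<or> emeasure \<mu> C = emeasure \<mu> A)"

definition atomless :: "config measure \<Rightarrow> bool" where
  "atomless \<mu> \<longleftrightarrow> (\<nexists>A. atom_of \<mu> A)"

definition setY :: "config set" where
  "setY = {x \<in> spaceX. x (0, 0) = 1}"

text \<open>Only the values of \<open>sigmaY\<close> on \<open>Y\<close> matter.\<close>

definition sigmaY :: "config \<Rightarrow> config" where
  "sigmaY x = (if shiftT x \<in> setY then shiftT x else shiftS x)"

lemma exactly_one_in_setY:
  assumes "x \<in> setY"
  shows "shiftT x \<in> setY \<longleftrightarrow> shiftS x \<notin> setY"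
proof -
  have X: "x \<in> spaceX" and x0: "x (0, 0) = 1"
    using assms by (auto simp: setY_def)
  have "x (0, 0) + x (0 + 1, 0) + x (0, 0 + 1) = 0"
    using X unfolding spaceX_def by blast
  then have "x (1, 0) = 1 \<longleftrightarrow> x (0, 1) \<noteq> 1"
    using x0 by (cases "x (1, 0)"; cases "x (0, 1)") simp_all
  moreover have "shiftT x \<in> spaceX" "shiftS x \<in> spaceX"
    using X by (simp_all add: shiftT_eq_act shiftS_eq_act act_in_spaceX)
  ultimately show ?thesis
    by (simp add: setY_def shiftT_def shiftS_def)
qed

lemma sigmaY_in_setY: "x \<in> setY \<Longrightarrow> sigmaY x \<in> setY"
  using exactly_one_in_setY by (auto simp: sigmaY_def)

definition sigma_component :: "config \<Rightarrow> config set" where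
  "sigma_component x =
     {y \<in> setY. y \<in> orbit x \<and> (\<exists>p q. (sigmaY ^^ p) x = (sigmaY ^^ q) y)}"

definition sigma_antecedents :: "config \<Rightarrow> config set" where
  "sigma_antecedents x = {y \<in> setY. \<exists>n\<ge>1. (sigmaY ^^ n) y = x}"

definition setZ :: "config set" where
  "setZ = {x \<in> setY. infinite (sigma_antecedents x)}"

text \<open>
  Membership in \<open>null_sets \<mu>\<close> includes measurability of \<open>setZ\<close>;
  \<open>emeasure \<mu> setZ = 0\<close> alone would also hold if \<open>setZ\<close> were not measurable.
\<close>

definition tree_type :: "config measure \<Rightarrow> bool" where
  "tree_type \<mu> \<longleftrightarrow>
     borel_probability \<mu> \<and> atomless \<mu> \<and> invariant_measure \<mu> \<and> ergodic_measure \<mu> \<and>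
     setZ \<in> null_sets \<mu> \<and>
     (\<exists>B\<in>sets borelX. invariant_set B \<and> emeasure \<mu> B = 1 \<and>
        (\<forall>x\<in>setY \<inter> B. orbit x \<inter> setY \<subseteq> sigma_component x))"

end

theory Submission
  imports Defs
begin

text \<open>
  Call the antidiagonal \<open>k + l = n\<close> the row \<open>n\<close>. The defining relation
  \<open>x (k, l) = x (k + 1, l) + x (k, l + 1)\<close> says that a row is the discrete derivative of the
  next one. So a row determines all earlier ones, and every sequence of bits is a row
  \<open>n\<close> of some point of \<open>X\<close>, the next row being then known up to adding the constant \<open>1\<close>
  (\<open>ex_config_with_row\<close>). Translating by well-chosen points of \<open>X\<close> flips selected bits, and this
  shows that under a Haar measure the bits of each row are independent fair coins
  (\<open>prob_row_cylinder\<close>). Cylinders over growing windows of rows generate the Borel sets,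
  which gives uniqueness of the Haar measure and hence its invariance under \<open>act\<close>. The measure has
  no atom because a point has probability at most \<open>2\<^sup>-\<^sup>n\<close> for every \<open>n\<close>. For ergodicity, let \<open>B\<close> be
  an invariant set. Far translates of a cylinder along its row are pairwise independent and
  equally correlated with \<open>B\<close>; an \<open>L\<^sup>2\<close> estimate makes this correlation vanish, so \<open>B\<close> is
  independent of every Borel set, itself included.

  For the dynamics, call a site occupied when its bit is \<open>1\<close>. An occupied site has exactly one occupied
  site among its right and upper neighbours, and following these neighbours realises
  \<open>\<sigma>\<close> as a system of paths in the lattice. Given the rows up to \<open>n\<close>, the two candidates for row
  \<open>n + 1\<close> are complementary and equally likely, so each path goes right with probability \<open>1/2\<close> at each
  step, independently of the past. For two paths that start on one row, the horizontal distance
  \<open>gap\<close> therefore has constant expectation, and it never becomes negative. If both paths start at occupied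
  sites at distance at most \<open>M\<close> and the left path goes right \<open>M * M\<close> times, the paths have merged
  (\<open>merge_after_right_run\<close>): otherwise both paths would contain long horizontal segments of ones, but above
  such a segment there is a triangle of zeros. By Markov's inequality the distance at any time exceeds
  \<open>M\<close> with probability at most \<open>d / M\<close>, where \<open>d\<close> is the initial distance. So the probability \<open>u n\<close>
  of not having merged after \<open>n\<close> steps drops, every \<open>M * M\<close> steps, by a fixed fraction of
  \<open>u n - d / M\<close>. Its limit is therefore at most \<open>d / M\<close> for all \<open>M\<close>, so it is \<open>0\<close>
  (\<open>prob_never_merge\<close>). Almost surely all paths of a configuration merge, which is the
  condition on \<open>\<sigma>\<close>-components.

  Finally, every point of \<open>Z\<close> is the image under \<open>\<sigma>\<close> of a point of \<open>Z\<close>, whereas \<open>\<sigma>\<close> is made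
  of two measure-preserving pieces. By comparing measures, almost no point is the image of two
  points of \<open>Z\<close> at once (\<open>prob_via_both\<close>). Since all paths merge, the orbit of almost every
  point then meets \<open>Z\<close> at most once on each row (\<open>setZ_sites_on_level_unique\<close>). The
  infinitely many translates of \<open>Z\<close> along a row have equal measure and are almost disjoint, so
  \<open>Z\<close> is null.
\<close>

section \<open>Configurations with a prescribed antidiagonal\<close>

lemma bit_eq_iff_add: "(a::bit) + b + c = 0 \<longleftrightarrow> a = b + c"
  by (cases a; cases b; cases c) simp_all

lemma spaceX_iff: "x \<in> spaceX \<longleftrightarrow> (\<forall>k l. x (k, l) = x (k + 1, l) + x (k, l + 1))"
  unfolding spaceX_def bit_eq_iff_add by simp

lemma spaceXD: "x \<in> spaceX \<Longrightarrow> x (k, l) = x (k + 1, l) + x (k, l + 1)"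
  unfolding spaceX_iff by blast

text \<open>
  Running the lattice relation forward from one row to the next means integrating a sequence of bits.
\<close>

lemma ex_discrete_antiderivative:
  fixes r :: "int \<Rightarrow> bit"
  shows "\<exists>s. \<forall>k. r k = s (k + 1) + s k"
proof -
  define s where "s = (\<lambda>k. if 0 \<le> k then sum r {0..<k} else sum r {k..<0})"
  have "r k = s (k + 1) + s k" for k
  proof -
    consider "k \<ge> 0" | "k = -1" | "k < -1" by linarith
    then show ?thesis
    proof cases
      case 1
      then have "{0..<k+1} = insert k {0..<k}" by auto
      then have "s (k + 1) = r k + s k" using 1 by (simp add: s_def)
      then show ?thesis by (cases "r k"; cases "s k") simp_all
    next
      case 2
      then have "{k..<0} = {k}" by auto
      then show ?thesis using 2 by (simp add: s_def)
    next
      case 3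
      then have "{k..<0} = insert k {k+1..<0}" by auto
      then have "s k = r k + s (k + 1)" using 3 by (simp add: s_def)
      then show ?thesis by (cases "r k"; cases "s (k + 1)") simp_all
    qed
  qed
  then show ?thesis by blast
qed

lemma ex_config_with_row:
  fixes r :: "int \<Rightarrow> bit"
  shows "\<exists>x\<in>spaceX. \<forall>k. x (k, n - k) = r k"
proof -
  define up :: "(int \<Rightarrow> bit) \<Rightarrow> int \<Rightarrow> bit"
    where "up r = (SOME s. \<forall>k. r k = s (k + 1) + s k)" for r
  have up: "r k = up r (k + 1) + up r k" for r k
    using someI_ex[OF ex_discrete_antiderivative[of r]] unfolding up_def by blast
  define down :: "(int \<Rightarrow> bit) \<Rightarrow> int \<Rightarrow> bit"
    where "down r k = r (k + 1) + r k" for r k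
  define row where "row i = (if 0 \<le> i then (up ^^ nat i) r else (down ^^ nat (- i)) r)" for i
  have row: "row i k = row (i + 1) (k + 1) + row (i + 1) k" for i k
  proof -
    consider "i \<ge> 0" | "i < 0" by linarith
    then show ?thesis
    proof cases
      case 1
      then have "nat (i + 1) = Suc (nat i)" by simp
      with 1 have "row (i + 1) = up (row i)" by (simp add: row_def)
      then show ?thesis using up by simp
    next
      case 2
      then have "nat (- i) = Suc (nat (- (i + 1)))" by simp
      with 2 have "row i = down (row (i + 1))" by (auto simp: row_def)
      then show ?thesis by (simp add: down_def)
    qed
  qed
  define x where "x = (\<lambda>(k, l). row (k + l - n) k)"
  have "x \<in> spaceX"
    unfolding spaceX_iff x_def prod.case
  proof (intro allI)
    fix k l
    show "row (k + l - n) k = row (k + 1 + l - n) (k + 1) + row (k + (l + 1) - n) k"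
      using row[of "k + l - n" k] by (simp only: algebra_simps)
  qed
  moreover have "x (k, n - k) = r k" for k
    by (simp add: x_def row_def)
  ultimately show ?thesis by blast
qed

text \<open>
  The windows grow by \<open>2\<close> at both ends from one row to the next. The bits in the window of row
  \<open>n + 1\<close> therefore determine those in the window of row \<open>n\<close>, and every site is determined by all
  late windows.
\<close>

definition row_window :: "int \<Rightarrow> int set" where
  "row_window n = {-2*n .. 2*n}"

text \<open>
  The site \<open>(k, l)\<close> depends on the part of row \<open>n\<close> that lies to its upper right, namely the abscissas
  from \<open>k\<close> to \<open>n - l\<close>.
\<close>

lemma row_window_determines:
  assumes "x \<in> spaceX" "y \<in> spaceX"
    and eq: "\<And>k. a \<le> k \<Longrightarrow> k \<le> b \<Longrightarrow> x (k, n - k) = y (k, n - k)"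
    and "a \<le> k" "n - l \<le> b" "k + l \<le> n"
  shows "x (k, l) = y (k, l)"
  using assms(4-6)
proof (induction "nat (n - (k + l))" arbitrary: k l)
  case 0
  then have "l = n - k" by simp
  then show ?case using 0 eq[of k] by simp
next
  case (Suc j)
  have less: "k + l < n" and j: "j = nat (n - (k + 1 + l))" "j = nat (n - (k + (l + 1)))"
    using Suc(2) by linarith+
  have "x (k + 1, l) = y (k + 1, l)" "x (k, l + 1) = y (k, l + 1)"
    using less Suc(3-5) by (intro Suc(1) j; linarith)+
  then show ?case
    by (simp only: spaceXD[OF assms(1), of k l] spaceXD[OF assms(2), of k l])
qed

section \<open>The Borel structure\<close>

text \<open>
  Second countability makes the Borel sigma-algebra of the product equal to the product sigma-algebra, so
  that measurability into \<open>X\<close> can be tested on coordinates.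
\<close>

instance bit :: second_countable_topology
proof
  have "finite (UNIV :: bit set)"
    by (rule finite_subset[of _ "{0, 1}"]) auto
  then have "finite (UNIV :: bit set set)"
    by (simp add: Finite_Set.finite_set)
  then show "\<exists>B::bit set set. countable B \<and> open = generate_topology B"
    by (intro exI[of _ UNIV])
       (auto simp: fun_eq_iff open_bit_def countable_finite intro: generate_topology.Basis)
qed

lemma space_borelX [simp]: "space borelX = spaceX"
  by (simp add: borelX_def space_restrict_space)

lemma borel_bit: "sets (borel :: bit measure) = UNIV"
  by (auto simp: open_bit_def intro: borel_open)

lemma measurable_bit: "M \<rightarrow>\<^sub>M (borel :: bit measure) = M \<rightarrow>\<^sub>M count_space UNIV"
  by (rule measurable_cong_sets) (simp_all add: borel_bit)

lemma measurable_coord [measurable]: "(\<lambda>x. x i) \<in> borelX \<rightarrow>\<^sub>M count_space UNIV"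
proof -
  have "(\<lambda>x::config. x i) \<in> borel \<rightarrow>\<^sub>M borel"
    by (intro borel_measurable_continuous_onI continuous_on_product_coordinates)
  then have "(\<lambda>x::config. x i) \<in> borel \<rightarrow>\<^sub>M count_space UNIV"
    unfolding measurable_bit .
  then show ?thesis
    unfolding borelX_def by (rule measurable_restrict_space1)
qed

lemma measurable_into_borelX:
  assumes X: "\<And>x. x \<in> space M \<Longrightarrow> f x \<in> spaceX"
    and coord: "\<And>i. (\<lambda>x. f x i) \<in> M \<rightarrow>\<^sub>M count_space UNIV"
  shows "f \<in> M \<rightarrow>\<^sub>M borelX"
proof -
  have "(\<lambda>x. f x i) \<in> M \<rightarrow>\<^sub>M borel" for i
    using coord[of i] unfolding measurable_bit .
  then have "f \<in> M \<rightarrow>\<^sub>M borel"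
    by (rule measurable_coordinatewise_then_product)
  then show ?thesis
    unfolding borelX_def by (rule measurable_restrict_space2[rotated]) (use X in auto)
qed

lemma pred_eq_config:
  assumes "f \<in> M \<rightarrow>\<^sub>M borelX" "g \<in> M \<rightarrow>\<^sub>M borelX"
  shows "Measurable.pred M (\<lambda>x. f x = g x)"
proof -
  have [measurable]: "(\<lambda>x. f x i) \<in> M \<rightarrow>\<^sub>M count_space UNIV"
    "(\<lambda>x. g x i) \<in> M \<rightarrow>\<^sub>M count_space UNIV" for i
    using measurable_compose[OF assms(1) measurable_coord]
      measurable_compose[OF assms(2) measurable_coord] by blast+
  have "Measurable.pred M (\<lambda>x. f x i = g x i)" for i
  proof -
    have "(f x i = g x i) = ((f x i = 0) = (g x i = 0))" for x
      by (cases "f x i"; cases "g x i") simp_all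
    then show ?thesis by simp
  qed
  then show ?thesis unfolding fun_eq_iff by measurable
qed

lemma act_site: "act v x s = x (s + v)"
  by (cases s; cases v) (simp add: act_def)

lemma act_add: "act v (act w x) = act (v + w) x"
  by (simp add: act_act plus_prod_def)

lemma measurable_act [measurable]: "act v \<in> borelX \<rightarrow>\<^sub>M borelX"
proof (rule measurable_into_borelX)
  fix i show "(\<lambda>x. act v x i) \<in> borelX \<rightarrow>\<^sub>M count_space UNIV"
    unfolding act_def by (cases i) simp
qed (simp add: act_in_spaceX)

definition translate :: "config \<Rightarrow> config \<Rightarrow> config" where
  "translate a x = (\<lambda>i. a i + x i)"

lemma translate_in_spaceX:
  assumes "a \<in> spaceX" "x \<in> spaceX" shows "translate a x \<in> spaceX"
  unfolding spaceX_iff translate_def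
proof (intro allI)
  fix k l
  show "a (k, l) + x (k, l) = a (k + 1, l) + x (k + 1, l) + (a (k, l + 1) + x (k, l + 1))"
    by (subst spaceXD[OF assms(1)], subst spaceXD[OF assms(2)]) (simp only: ac_simps)
qed

lemma measurable_translate:
  assumes "a \<in> spaceX" shows "translate a \<in> borelX \<rightarrow>\<^sub>M borelX"
proof (rule measurable_into_borelX)
  fix i show "(\<lambda>x. translate a x i) \<in> borelX \<rightarrow>\<^sub>M count_space UNIV"
    unfolding translate_def
    by (rule measurable_compose[OF measurable_coord, of "\<lambda>b. a i + b"]) simp
qed (simp add: translate_in_spaceX assms)

section \<open>A generating class of cylinders\<close>

definition row_cylinder :: "int \<Rightarrow> int set \<Rightarrow> (int \<Rightarrow> bit) \<Rightarrow> config set" where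
  "row_cylinder n K w = {x \<in> spaceX. \<forall>k\<in>K. x (k, n - k) = w k}"

lemma row_cylinder_sets [measurable]: "row_cylinder n K w \<in> sets borelX"
proof -
  have "{x \<in> space borelX. \<forall>k\<in>K. x (k, n - k) = w k} \<in> sets borelX"
    by measurable
  then show ?thesis by (simp add: row_cylinder_def)
qed

text \<open>
  Only one window per row is used: two such cylinders are then nested or disjoint, which makes the
  class closed under intersection. The empty set and the whole space complete it.
\<close>

definition cylinders :: "config set set" where
  "cylinders = insert {} (insert spaceX
     {row_cylinder (int n) (row_window (int n)) w | n w. True})"

lemma Int_stable_cylinders: "Int_stable cylinders"
proof -
  have nested: "row_cylinder (int m) (row_window (int m)) v
      \<inter> row_cylinder (int n) (row_window (int n)) w \<in> cylinders"
    if "m \<le> n" for m n v w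
  proof (cases "row_cylinder (int m) (row_window (int m)) v
      \<inter> row_cylinder (int n) (row_window (int n)) w = {}")
    case False
    then obtain y where y: "y \<in> spaceX" "\<forall>k\<in>row_window (int m). y (k, int m - k) = v k"
      "\<forall>k\<in>row_window (int n). y (k, int n - k) = w k"
      by (auto simp: row_cylinder_def)
    have "x (k, int m - k) = v k" if x: "x \<in> row_cylinder (int n) (row_window (int n)) w"
        and k: "k \<in> row_window (int m)" for x k
    proof -
      have "x (k, int m - k) = y (k, int m - k)"
        by (rule row_window_determines[where n = "int n" and a = "-2*int n" and b = "2*int n"])
           (use x k y \<open>m \<le> n\<close> in \<open>auto simp: row_cylinder_def row_window_def\<close>)
      then show ?thesis using y k by simp
    qed
    then have "row_cylinder (int m) (row_window (int m)) v
        \<inter> row_cylinder (int n) (row_window (int n)) w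
        = row_cylinder (int n) (row_window (int n)) w"
      by (auto simp: row_cylinder_def)
    then show ?thesis by (auto simp: cylinders_def)
  qed (simp add: cylinders_def)
  have sub: "row_cylinder n K w \<subseteq> spaceX" for n K w
    by (auto simp: row_cylinder_def)
  show ?thesis
  proof (rule Int_stableI)
    fix A B assume "A \<in> cylinders" "B \<in> cylinders"
    then consider "A = {} \<or> B = {}" | "A = spaceX" "B \<subseteq> spaceX" | "B = spaceX" "A \<subseteq> spaceX"
      | m n v w where "A = row_cylinder (int m) (row_window (int m)) v"
        "B = row_cylinder (int n) (row_window (int n)) w"
      using sub by (auto simp: cylinders_def)
    then show "A \<inter> B \<in> cylinders"
    proof cases
      case 4
      show ?thesis
      proof (cases "m \<le> n")
        case True then show ?thesis using nested 4 by simp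
      next
        case False then show ?thesis using nested[of n m] 4 by (simp add: Int_commute)
      qed
    qed (use \<open>A \<in> cylinders\<close> \<open>B \<in> cylinders\<close> in
        \<open>auto simp: Int_absorb1 Int_absorb2 cylinders_def\<close>)
  qed
qed

lemma cylinders_subset: "cylinders \<subseteq> sets borelX"
  using sets.top[of borelX] by (auto simp: cylinders_def)

text \<open>
  A site is a function of the bits in a sufficiently late window, so a condition on it is a finite union
  of cylinders over that window.
\<close>

lemma coord_in_sigma_cylinders:
  "{x \<in> spaceX. x (k, l) = c} \<in> sigma_sets spaceX cylinders"
proof -
  define n where "n = nat \<bar>k\<bar> + nat \<bar>l\<bar>"
  define K where "K = row_window (int n)"
  let ?A = "{x \<in> spaceX. x (k, l) = c}"
  let ?C = "(\<lambda>x. row_cylinder (int n) K (\<lambda>k. x (k, int n - k))) ` ?A"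
  have det: "y (k, l) = c" if "x \<in> ?A" "y \<in> row_cylinder (int n) K (\<lambda>k. x (k, int n - k))" for x y
  proof -
    have "y (k, l) = x (k, l)"
      by (rule row_window_determines[where n = "int n" and a = "-2*int n" and b = "2*int n"])
         (use that in \<open>auto simp: row_cylinder_def row_window_def K_def n_def\<close>)
    then show ?thesis using that by simp
  qed
  have fin: "finite (PiE K (\<lambda>_. UNIV :: bit set))"
  proof (rule finite_PiE)
    show "finite (UNIV :: bit set)"
      by (rule finite_subset[of _ "{0, 1}"]) auto
  qed (simp add: K_def row_window_def)
  have "?C \<subseteq> row_cylinder (int n) K ` (PiE K (\<lambda>_. UNIV))"
  proof safe
    fix x
    have "row_cylinder (int n) K (\<lambda>k. x (k, int n - k))
        = row_cylinder (int n) K (restrict (\<lambda>k. x (k, int n - k)) K)"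
      by (simp add: row_cylinder_def)
    then show "row_cylinder (int n) K (\<lambda>k. x (k, int n - k))
        \<in> row_cylinder (int n) K ` (PiE K (\<lambda>_. UNIV))"
      by (rule ssubst) (rule imageI, simp only: restrict_PiE_iff, simp)
  qed
  then have "finite ?C" using fin by (meson finite_imageI finite_subset)
  moreover have "?C \<subseteq> sigma_sets spaceX cylinders"
    by (auto simp: cylinders_def K_def intro!: sigma_sets.Basic)
  ultimately have "\<Union>?C \<in> sigma_sets spaceX cylinders"
    by (meson countable_finite sigma_sets_UNION subsetD)
  moreover have "\<Union>?C = ?A"
  proof
    show "\<Union>?C \<subseteq> ?A" using det by (auto simp: row_cylinder_def)
    show "?A \<subseteq> \<Union>?C" by (force simp: row_cylinder_def)
  qed
  ultimately show ?thesis by simp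
qed

lemma sets_borelX_eq: "sets borelX = sigma_sets spaceX cylinders"
proof
  have Pow: "cylinders \<subseteq> Pow spaceX"
    using cylinders_subset sets.sets_into_space[of _ borelX] by auto
  show "sigma_sets spaceX cylinders \<subseteq> sets borelX"
    using sets.sigma_sets_subset[OF cylinders_subset] by simp
  have "(\<lambda>x. x) \<in> sigma spaceX cylinders \<rightarrow>\<^sub>M borelX"
  proof (rule measurable_into_borelX)
    fix i :: "int \<times> int"
    have fin: "finite (UNIV :: bit set)"
      by (rule finite_subset[of _ "{0, 1}"]) auto
    show "(\<lambda>x. x i) \<in> sigma spaceX cylinders \<rightarrow>\<^sub>M count_space UNIV"
    proof (subst measurable_count_space_eq2[OF fin], safe)
      fix c
      have "(\<lambda>x. x i) -` {c} \<inter> spaceX = {x \<in> spaceX. x i = c}" by auto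
      moreover obtain k l where "i = (k, l)" by fastforce
      ultimately
      show "(\<lambda>x. x i) -` {c} \<inter> space (sigma spaceX cylinders) \<in> sets (sigma spaceX cylinders)"
        using coord_in_sigma_cylinders Pow by simp
    qed simp
  qed (use Pow in simp)
  then have "A \<in> sets borelX \<Longrightarrow> (\<lambda>x. x) -` A \<inter> spaceX \<in> sigma_sets spaceX cylinders" for A
    using measurable_sets[of "\<lambda>x. x" "sigma spaceX cylinders" borelX A] Pow by simp
  then show "sets borelX \<subseteq> sigma_sets spaceX cylinders"
    using sets.sets_into_space[of _ borelX] by (auto simp: Int_absorb2)
qed

lemma translate_apply: "translate a x i = a i + x i"
  by (simp only: translate_def)

section \<open>Haar measure is the fair coin-tossing measure on every antidiagonal\<close>

locale haar_measure = prob_space \<mu> for \<mu> :: "config measure" +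
  assumes sets_eq: "sets \<mu> = sets borelX"
    and distr_translate: "a \<in> spaceX \<Longrightarrow> distr \<mu> \<mu> (translate a) = \<mu>"
begin

lemma space_eq [simp]: "space \<mu> = spaceX"
  using sets_eq_imp_space_eq[OF sets_eq] by simp

lemma measurable_eq: "measurable \<mu> N = measurable borelX N"
  "measurable N \<mu> = measurable N borelX"
  by (rule measurable_cong_sets; simp add: sets_eq)+

lemma coord_measurable [measurable]: "(\<lambda>x. x i) \<in> \<mu> \<rightarrow>\<^sub>M count_space UNIV"
  by (simp add: measurable_eq)

lemma act_measurable [measurable]: "act v \<in> \<mu> \<rightarrow>\<^sub>M \<mu>"
  by (simp add: measurable_eq)

lemma prob_translate:
  assumes "a \<in> spaceX" "A \<in> events"
  shows "prob {x \<in> spaceX. translate a x \<in> A} = prob A"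
proof -
  have "prob A = measure (distr \<mu> \<mu> (translate a)) A"
    using distr_translate[OF assms(1)] by simp
  also have "\<dots> = prob (translate a -` A \<inter> space \<mu>)"
    by (rule measure_distr) (simp_all add: measurable_eq measurable_translate assms)
  also have "translate a -` A \<inter> space \<mu> = {x \<in> spaceX. translate a x \<in> A}"
    by auto
  finally show ?thesis by simp
qed

text \<open>
  Translation by \<open>a\<close> preserves the measure, fixes \<open>D\<close> and exchanges the parts of \<open>D\<close> inside and outside
  \<open>E\<close>. The independence of single bits and of step directions comes from this symmetry, for suitable choices
  of \<open>a\<close>.
\<close>

lemma prob_flip:
  assumes a: "a \<in> spaceX" and D: "D \<in> events" and E: "E \<in> events"
    and inv: "\<And>x. x \<in> spaceX \<Longrightarrow> translate a x \<in> D \<longleftrightarrow> x \<in> D"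
    and flip: "\<And>x. x \<in> D \<Longrightarrow> translate a x \<in> E \<longleftrightarrow> x \<notin> E"
  shows "prob (D \<inter> E) = prob D / 2"
proof -
  have "{x \<in> spaceX. translate a x \<in> D \<inter> E} = D - E"
    using inv flip sets.sets_into_space[OF D] by auto
  then have "prob (D \<inter> E) = prob (D - E)"
    using prob_translate[OF a, of "D \<inter> E"] D E by simp
  moreover have "prob D = prob (D \<inter> E) + prob (D - E)"
    using finite_measure_Union[of "D \<inter> E" "D - E"] D E by (simp add: Int_Diff_Un Int_Diff_disjoint)
  ultimately show ?thesis by simp
qed

text \<open>
  Each further prescribed bit halves the probability, by translating with a point whose row \<open>n\<close> is
  zero except at that bit.
\<close>

lemma prob_row_cylinder:
  assumes "finite K"
  shows "prob (row_cylinder n K w) = (1/2) ^ card K"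
  using assms
proof induction
  case empty
  show ?case using prob_space by (simp add: row_cylinder_def)
next
  case (insert k K)
  obtain a where a: "a \<in> spaceX" "\<And>j. a (j, n - j) = (if j = k then 1 else 0)"
    using ex_config_with_row[of n "\<lambda>j. if j = k then 1 else 0"] by blast
  have "prob (row_cylinder n K w \<inter> row_cylinder n {k} w) = prob (row_cylinder n K w) / 2"
  proof (rule prob_flip[OF a(1)])
    fix x assume "x \<in> spaceX"
    then show "translate a x \<in> row_cylinder n K w \<longleftrightarrow> x \<in> row_cylinder n K w"
      using insert(2) a by (auto simp: row_cylinder_def translate_in_spaceX translate_apply)
  next
    fix x assume "x \<in> row_cylinder n K w"
    then have "x \<in> spaceX" by (simp add: row_cylinder_def)
    moreover have "translate a x (k, n - k) = w k \<longleftrightarrow> x (k, n - k) \<noteq> w k"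
      unfolding translate_apply a(2) by (cases "w k"; cases "x (k, n - k)") simp_all
    ultimately show "translate a x \<in> row_cylinder n {k} w \<longleftrightarrow> x \<notin> row_cylinder n {k} w"
      using translate_in_spaceX[OF a(1)] by (simp add: row_cylinder_def)
  qed (simp_all add: sets_eq row_cylinder_sets)
  moreover have "row_cylinder n K w \<inter> row_cylinder n {k} w = row_cylinder n (insert k K) w"
    by (auto simp: row_cylinder_def)
  ultimately show ?case using insert by simp
qed

end

lemma haar_measureI:
  assumes "haar_probability \<mu>" shows "haar_measure \<mu>"
proof -
  interpret prob_space \<mu>
    using assms by (simp add: haar_probability_def borel_probability_def)
  show ?thesis
  proof
    show "sets \<mu> = sets borelX"
      using assms by (simp add: haar_probability_def borel_probability_def)
    fix a assume "a \<in> spaceX"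
    then have "distr \<mu> \<mu> (\<lambda>x i. a i + x i) = \<mu>"
      using assms unfolding haar_probability_def by blast
    then show "distr \<mu> \<mu> (translate a) = \<mu>"
      unfolding translate_def .
  qed
qed

text \<open>
  A Haar measure is determined on \<open>cylinders\<close>, which is closed under intersection and generates the
  Borel sets. The use of this is to identify the image of a Haar measure under \<open>act v\<close>.
\<close>

lemma haar_measure_unique:
  assumes "haar_measure \<mu>" "haar_measure \<nu>" shows "\<mu> = \<nu>"
proof -
  interpret m: haar_measure \<mu> by fact
  interpret n: haar_measure \<nu> by fact
  show ?thesis
  proof (rule measure_eqI_generator_eq[OF Int_stable_cylinders, of spaceX _ _ "\<lambda>_. spaceX"])
    show "cylinders \<subseteq> Pow spaceX"
      using cylinders_subset sets.sets_into_space[of _ borelX] by auto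
    fix A assume "A \<in> cylinders"
    then consider "A = {}" | "A = spaceX"
      | n w where "A = row_cylinder (int n) (row_window (int n)) w"
      by (auto simp: cylinders_def)
    then show "emeasure \<mu> A = emeasure \<nu> A"
    proof cases
      case 2
      then show ?thesis using m.emeasure_space_1 n.emeasure_space_1 by simp
    next
      case 3
      then show ?thesis
        by (simp add: m.emeasure_eq_measure n.emeasure_eq_measure m.prob_row_cylinder
            n.prob_row_cylinder row_window_def)
    qed simp
  qed (simp_all add: m.sets_eq n.sets_eq sets_borelX_eq cylinders_def)
qed

lemma act_translate: "act v (translate a x) = translate (act v a) (act v x)"
  by (simp add: act_def translate_def fun_eq_iff)

context haar_measure
begin

text \<open>
  Since \<open>act v\<close> is an automorphism of the group \<open>X\<close>, the image measure is again a Haar measure.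
\<close>

lemma distr_act: "distr \<mu> \<mu> (act v) = \<mu>"
proof -
  let ?\<nu> = "distr \<mu> \<mu> (act v)"
  interpret n: prob_space ?\<nu> by (rule prob_space_distr) measurable
  have "haar_measure ?\<nu>"
  proof unfold_locales
    fix a assume a: "a \<in> spaceX"
    define b where "b = act (- fst v, - snd v) a"
    have b: "b \<in> spaceX" "act v b = a"
      using a by (simp_all add: b_def act_in_spaceX act_act act_zero)
    have meas: "translate c \<in> \<mu> \<rightarrow>\<^sub>M \<mu>" if "c \<in> spaceX" for c
      using measurable_translate[OF that] by (simp add: measurable_eq)
    have "distr ?\<nu> ?\<nu> (translate a) = distr ?\<nu> \<mu> (translate a)"
      by (rule distr_cong) simp_all
    also have "\<dots> = distr \<mu> \<mu> (translate a \<circ> act v)"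
      by (rule distr_distr) (simp_all add: meas a)
    also have "translate a \<circ> act v = act v \<circ> translate b"
      by (simp add: fun_eq_iff act_translate b)
    also have "distr \<mu> \<mu> (act v \<circ> translate b) = distr (distr \<mu> \<mu> (translate b)) \<mu> (act v)"
      by (rule distr_distr[symmetric]) (simp_all add: meas b)
    also have "\<dots> = ?\<nu>" by (simp add: distr_translate b)
    finally show "distr ?\<nu> ?\<nu> (translate a) = ?\<nu>" .
  qed (simp add: sets_eq)
  then show ?thesis
    by (rule haar_measure_unique) unfold_locales
qed

lemma invariant_measure: "invariant_measure \<mu>"
  by (simp add: invariant_measure_def distr_act)

lemma act_vimage_events:
  assumes "A \<in> events" shows "{x \<in> spaceX. act v x \<in> A} \<in> events"
proof -
  have "act v -` A \<inter> space \<mu> \<in> events" using assms by measurable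
  also have "act v -` A \<inter> space \<mu> = {x \<in> spaceX. act v x \<in> A}" by auto
  finally show ?thesis .
qed

lemma prob_act:
  assumes "A \<in> events"
  shows "prob {x \<in> spaceX. act v x \<in> A} = prob A"
proof -
  have "prob A = measure (distr \<mu> \<mu> (act v)) A" by (simp add: distr_act)
  also have "\<dots> = prob (act v -` A \<inter> space \<mu>)"
    by (rule measure_distr) (simp_all add: assms)
  also have "act v -` A \<inter> space \<mu> = {x \<in> spaceX. act v x \<in> A}" by auto
  finally show ?thesis by simp
qed

text \<open>
  On an atom every coordinate is almost surely constant, so an atom carries the mass of a
  single point. But a point lies in cylinders of arbitrarily small measure.
\<close>

lemma atomless: "atomless \<mu>"
  unfolding atomless_def
proof
  assume "\<exists>A. atom_of \<mu> A"
  then obtain A where A: "A \<in> events" "prob A > 0"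
    and dich: "\<And>C. C \<in> events \<Longrightarrow> C \<subseteq> A \<Longrightarrow> prob C = 0 \<or> prob C = prob A"
    by (auto simp: atom_of_def emeasure_eq_measure)
  define E where "E i c = {x \<in> A. x i = c}" for i c
  have E [measurable]: "E i c \<in> events" for i c
  proof -
    have "A \<inter> {x \<in> space \<mu>. x i = c} \<in> events" using A by measurable
    also have "A \<inter> {x \<in> space \<mu>. x i = c} = E i c"
      using sets.sets_into_space[OF A(1)] by (auto simp: E_def)
    finally show ?thesis .
  qed
  \<comment> \<open>Here \<open>c + 1\<close> is the bit other than \<open>c\<close>.\<close>
  have "\<exists>c. prob (E i (c + 1)) = 0" for i
  proof -
    have "prob (E i 0) + prob (E i 1) = prob (E i 0 \<union> E i 1)"
      by (rule finite_measure_Union[symmetric]) (auto simp: E_def E[unfolded E_def])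
    also have "E i 0 \<union> E i 1 = A" by (auto simp: E_def)
    finally have "prob (E i 0) = 0 \<or> prob (E i 1) = 0"
      using dich[of "E i 0"] dich[of "E i 1"] E by (auto simp: E_def)
    then show ?thesis
    proof
      assume "prob (E i 0) = 0" then show ?thesis by (intro exI[of _ 1]) simp
    next
      assume "prob (E i 1) = 0" then show ?thesis by (intro exI[of _ 0]) simp
    qed
  qed
  then obtain c where c: "\<And>i. prob (E i (c i + 1)) = 0" by metis
  have "(\<Union>i. E i (c i + 1)) \<in> null_sets \<mu>"
    by (rule null_sets_UN) (use c in \<open>auto simp: null_sets_def emeasure_eq_measure\<close>)
  then have diff: "prob (A - (\<Union>i. E i (c i + 1))) = prob A"
    using A by (simp add: measure_Diff_null_set)
  have "x = c" if "x \<in> A - (\<Union>i. E i (c i + 1))" for x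
  proof
    fix i show "x i = c i"
    proof (rule ccontr)
      assume "x i \<noteq> c i"
      then have "x i = c i + 1" by (cases "x i"; cases "c i") simp_all
      then have "x \<in> E i (c i + 1)" using that unfolding E_def by blast
      then show False using that by blast
    qed
  qed
  then have sub: "A - (\<Union>i. E i (c i + 1)) \<subseteq> {c} \<inter> spaceX"
    using sets.sets_into_space[OF A(1)] by auto
  have "prob A \<le> (1/2) ^ n" for n
  proof -
    have "prob A \<le> prob (row_cylinder 0 {0..<int n} (\<lambda>k. c (k, 0 - k)))"
      unfolding diff[symmetric]
    proof (rule finite_measure_mono)
      show "A - (\<Union>i. E i (c i + 1)) \<subseteq> row_cylinder 0 {0..<int n} (\<lambda>k. c (k, 0 - k))"
        using sub by (auto simp: row_cylinder_def)
    qed (simp only: sets_eq row_cylinder_sets)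
    then show ?thesis by (simp add: prob_row_cylinder)
  qed
  moreover obtain n where "(1/2) ^ n < prob A"
    using real_arch_pow_inv[OF A(2), of "1/2"] by auto
  ultimately show False by (meson not_le)
qed

end

section \<open>Ergodicity\<close>

text \<open>
  This converts the \<open>L\<^sup>2\<close> estimate in the proof of ergodicity into an equality.
\<close>

lemma zero_if_square_multiples_grow_linearly:
  fixes d :: real
  assumes "\<And>N::nat. (real N * d)\<^sup>2 \<le> real N" shows "d = 0"
proof (rule ccontr)
  assume "d \<noteq> 0"
  then have "\<exists>N. 1 < real N * d\<^sup>2"
    using reals_Archimedean3[of "d\<^sup>2"] by simp
  then obtain N :: nat where N: "1 < real N * d\<^sup>2" ..
  then have "N > 0" by (cases N) auto
  then show False
    using assms[of N] N mult_strict_left_mono[OF N, of "real N"]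
    by (simp add: power2_eq_square ac_simps)
qed

context haar_measure
begin

text \<open>
  Let \<open>C j\<close> be the given cylinder moved by \<open>j * m\<close> along its row, where \<open>m\<close> is so large that the
  windows are disjoint. The centred indicators of the \<open>C j\<close> are orthogonal in \<open>L\<^sup>2\<close>, so the sum
  of \<open>N\<close> of them has squared norm at most \<open>N\<close>. By invariance of \<open>B\<close>, each of them has the same
  inner product with the indicator of \<open>B\<close>; the sum gives \<open>N\<close> times that number, whose square is at most
  \<open>N\<close> by the Cauchy-Schwarz inequality. This forces the inner product to be \<open>0\<close>.
\<close>

lemma prob_Int_invariant_row_cylinder:
  assumes B: "B \<in> events" and inv: "\<And>v x. x \<in> spaceX \<Longrightarrow> act v x \<in> B \<longleftrightarrow> x \<in> B"
    and K: "finite K"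
  shows "prob (B \<inter> row_cylinder n K w) = prob B * prob (row_cylinder n K w)"
proof -
  \<comment> \<open>Larger than the difference of any two elements of \<open>K\<close>.\<close>
  define m where "m = 1 + 2 * (\<Sum>k\<in>K. \<bar>k\<bar>)"
  have bound: "\<bar>k\<bar> \<le> (\<Sum>k\<in>K. \<bar>k\<bar>)" if "k \<in> K" for k
    using that K by (intro member_le_sum) auto
  define S where "S j = (\<lambda>k. k + int j * m) ` K" for j :: nat
  have card_S: "card (S j) = card K" "finite (S j)" for j
    unfolding S_def using K by (auto intro: card_image simp: inj_on_def)
  have disj: "S i \<inter> S j = {}" if "i \<noteq> j" for i j
  proof (rule ccontr)
    assume "S i \<inter> S j \<noteq> {}"
    then obtain k l where kl: "k \<in> K" "l \<in> K" "k + int i * m = l + int j * m"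
      by (auto simp: S_def)
    then have eq: "k - l = (int j - int i) * m" by (simp add: algebra_simps)
    have "\<bar>k - l\<bar> < m" using bound[OF kl(1)] bound[OF kl(2)] by (simp add: m_def)
    moreover have "m \<ge> 0" by (simp add: m_def sum_nonneg)
    moreover have "\<bar>int j - int i\<bar> \<ge> 1" using that by auto
    ultimately show False
      using mult_right_mono[of 1 "\<bar>int j - int i\<bar>" m] by (simp add: eq abs_mult)
  qed
  define C where "C j = row_cylinder n (S j) (\<lambda>k. w (k - int j * m))" for j
  define c where "c = prob (row_cylinder n K w)"
  have C [measurable]: "C j \<in> events" for j
    by (simp add: C_def sets_eq row_cylinder_sets)
  have C_eq: "C j = {x \<in> spaceX. act (int j * m, - int j * m) x \<in> row_cylinder n K w}" for j
    unfolding C_def S_def row_cylinder_def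
    by (rule Collect_cong) (auto simp: act_site act_in_spaceX diff_diff_eq)
  have prob_BC: "prob (B \<inter> C j) = prob (B \<inter> row_cylinder n K w)" for j
  proof -
    have "B \<inter> C j = {x \<in> spaceX. act (int j * m, - int j * m) x \<in> B \<inter> row_cylinder n K w}"
      using inv sets.sets_into_space[OF B] by (auto simp: C_eq)
    then show ?thesis
      using B by (simp only: prob_act sets.Int sets_eq row_cylinder_sets)
  qed
  have prob_C: "prob (C j) = c" for j
    using K by (simp add: C_def c_def prob_row_cylinder card_S)
  have prob_CC: "prob (C i \<inter> C j) = c * c" if "i \<noteq> j" for i j
  proof -
    have "C i \<inter> C j = row_cylinder n (S i \<union> S j)
        (\<lambda>k. if k \<in> S i then w (k - int i * m) else w (k - int j * m))"
      using disj[OF that] by (auto simp: C_def row_cylinder_def)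
    then show ?thesis
      using disj[OF that] K
      by (simp add: prob_row_cylinder card_S c_def card_Un_disjoint power_add)
  qed
  have C_space [simp]: "C j \<inter> spaceX = C j" "C i \<inter> C j \<inter> spaceX = C i \<inter> C j" for i j
    by (auto simp: C_def row_cylinder_def)
  have B_space [simp]: "B \<inter> spaceX = B" "B \<inter> C j \<inter> spaceX = B \<inter> C j" for j
    using sets.sets_into_space[OF B] by auto
  define f where "f j x = indicator (C j) x - c" for j and x :: config
  have f_meas [measurable]: "f j \<in> borel_measurable \<mu>" for j
    unfolding f_def by measurable
  have c01: "0 \<le> c" "c \<le> 1" by (simp_all add: c_def)
  have bnd: "\<bar>f j x\<bar> \<le> 1" for j x
    using c01 by (auto simp: f_def indicator_def)
  have int_ff: "expectation (\<lambda>x. f i x * f j x) = (if i = j then c - c * c else 0)" for i j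
  proof -
    have eq: "f i x * f j x = indicator (C i \<inter> C j) x - c * indicator (C i) x
        - c * indicator (C j) x + c * c" for x
      by (simp add: f_def indicator_inter_arith algebra_simps)
    have "expectation (\<lambda>x. f i x * f j x) = prob (C i \<inter> C j) - c * prob (C i) - c * prob (C j) + c * c"
      unfolding eq using prob_space by (simp add: emeasure_eq_measure Bochner_Integration.integral_add)
    then show ?thesis by (auto simp: prob_C prob_CC)
  qed
  have ff_integrable: "integrable \<mu> (\<lambda>x. f i x * f j x)" for i j
  proof (rule integrable_const_bound[where B = 1])
    show "AE x in \<mu>. norm (f i x * f j x) \<le> 1"
      by (intro AE_I2) (simp add: abs_mult mult_le_one bnd)
  qed measurable
  have f_integrable: "integrable \<mu> (\<lambda>x. indicator B x * f j x)" for j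
  proof (rule integrable_const_bound[where B = 1])
    show "AE x in \<mu>. norm (indicator B x * f j x) \<le> 1"
      by (intro AE_I2) (simp add: abs_mult bnd indicator_def)
  qed (use B in measurable)
  have int_Bf: "expectation (\<lambda>x. indicator B x * f j x) = prob (B \<inter> row_cylinder n K w) - prob B * c" for j
  proof -
    have eq: "indicator B x * f j x = indicator (B \<inter> C j) x - c * indicator B x" for x
      by (simp add: f_def indicator_inter_arith algebra_simps)
    show ?thesis unfolding eq using B
      by (simp add: emeasure_eq_measure prob_BC)
  qed
  have "(real N * (prob (B \<inter> row_cylinder n K w) - prob B * c))\<^sup>2 \<le> real N" for N
  proof -
    define g where "g x = (\<Sum>j<N. f j x)" for x
    define h where "h x = indicator B x * g x" for x
    have g_meas [measurable]: "g \<in> borel_measurable \<mu>" unfolding g_def by measurable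
    have h_meas [measurable]: "h \<in> borel_measurable \<mu>" unfolding h_def using B by measurable
    have g2: "(g x)\<^sup>2 = (\<Sum>i<N. \<Sum>j<N. f i x * f j x)" for x
      by (simp add: g_def power2_eq_square sum_product)
    have g2_integrable: "integrable \<mu> (\<lambda>x. (g x)\<^sup>2)"
      unfolding g2 by (intro Bochner_Integration.integrable_sum ff_integrable)
    have hg: "(h x)\<^sup>2 \<le> (g x)\<^sup>2" for x
      by (simp add: h_def indicator_def)
    have h_sum: "h x = (\<Sum>j<N. indicator B x * f j x)" for x
      by (simp add: h_def g_def sum_distrib_left)
    have h_integrable: "integrable \<mu> h"
      unfolding h_sum by (intro Bochner_Integration.integrable_sum f_integrable)
    have h2_integrable: "integrable \<mu> (\<lambda>x. (h x)\<^sup>2)"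
      by (rule Bochner_Integration.integrable_bound[OF g2_integrable]) (use hg in auto)
    have "expectation h = real N * (prob (B \<inter> row_cylinder n K w) - prob B * c)"
      unfolding h_sum
      by (subst Bochner_Integration.integral_sum)
         (simp_all only: f_integrable int_Bf sum_constant card_lessThan)
    \<comment> \<open>Cauchy-Schwarz against the constant \<open>1\<close>, in the form that a variance is nonnegative.\<close>
    moreover have "(expectation h)\<^sup>2 \<le> expectation (\<lambda>x. (h x)\<^sup>2)"
      using variance_positive[of h] variance_eq[OF h_integrable h2_integrable] by linarith
    moreover have "expectation (\<lambda>x. (h x)\<^sup>2) \<le> expectation (\<lambda>x. (g x)\<^sup>2)"
      by (intro integral_mono h2_integrable g2_integrable hg)
    moreover have "expectation (\<lambda>x. (g x)\<^sup>2) = real N * (c - c * c)"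
      unfolding g2 by (simp add: Bochner_Integration.integral_sum ff_integrable int_ff)
    moreover have "c - c * c \<le> 1"
      using c01 mult_nonneg_nonneg[of c c] by linarith
    then have "real N * (c - c * c) \<le> real N"
      by (intro mult_left_le) simp_all
    ultimately show ?thesis by simp
  qed
  then have "prob (B \<inter> row_cylinder n K w) - prob B * c = 0"
    by (rule zero_if_square_multiples_grow_linearly)
  then show ?thesis by (simp add: c_def)
qed

text \<open>
  An invariant set is independent of every cylinder, hence of every Borel set, hence of itself.
\<close>

lemma ergodic: "ergodic_measure \<mu>"
  unfolding ergodic_measure_def
proof (intro ballI impI)
  fix B assume B: "B \<in> events" and "invariant_set B"
  then have image: "act v ` B = B" for v unfolding invariant_set_def by blast
  have inv: "act v x \<in> B \<longleftrightarrow> x \<in> B" for v x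
  proof
    assume "act v x \<in> B"
    then have "act (- fst v, - snd v) (act v x) \<in> B" using image by blast
    then show "x \<in> B" by (simp add: act_act act_zero)
  qed (use image in blast)
  have "indep_set {B} cylinders"
  proof (rule indep_setI)
    fix a b assume a: "a \<in> {B}" and "b \<in> cylinders"
    then consider "b = {}" | "b = spaceX"
      | n w where "b = row_cylinder (int n) (row_window (int n)) w"
      by (auto simp: cylinders_def)
    then show "prob (a \<inter> b) = prob a * prob b"
    proof cases
      case 2
      then show ?thesis using a B prob_space sets.sets_into_space[OF B] by (simp add: Int_absorb2)
    next
      case 3
      then show ?thesis
        using a prob_Int_invariant_row_cylinder[OF B] inv by (simp add: row_window_def)
    qed simp
  qed (use B cylinders_subset sets_eq in auto)
  then have "indep_set (sigma_sets (space \<mu>) {B}) (sigma_sets (space \<mu>) cylinders)"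
    by (rule indep_set_sigma_sets) (rule Int_stable_cylinders | simp add: Int_stable_def)+
  moreover have "B \<in> sigma_sets (space \<mu>) {B}" by (rule sigma_sets.Basic) simp
  moreover have "B \<in> sigma_sets (space \<mu>) cylinders"
    using B by (simp add: sets_eq sets_borelX_eq)
  ultimately have "prob (B \<inter> B) = prob B * prob B" by (rule indep_setD)
  then have "prob B = 0 \<or> prob B = 1" by simp
  then show "emeasure \<mu> B = 0 \<or> emeasure \<mu> B = 1"
    by (auto simp: emeasure_eq_measure)
qed

end

section \<open>Paths of occupied sites\<close>

definition level :: "int \<times> int \<Rightarrow> int" where
  "level p = fst p + snd p"

text \<open>
  Paths are defined at all sites, occupied or not. Only occupied starting sites
  correspond to \<open>\<sigma>\<close>, but the distance of two paths has constant expectation for all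
  starting sites on one row.
\<close>

definition next_site :: "config \<Rightarrow> int \<times> int \<Rightarrow> int \<times> int" where
  "next_site x p = (if x (p + (1, 0)) = 1 then p + (1, 0) else p + (0, 1))"

primrec route :: "config \<Rightarrow> int \<times> int \<Rightarrow> nat \<Rightarrow> int \<times> int" where
  "route x p 0 = p"
| "route x p (Suc n) = next_site x (route x p n)"

definition goes_right :: "config \<Rightarrow> int \<times> int \<Rightarrow> nat \<Rightarrow> bool" where
  "goes_right x p n \<longleftrightarrow> x (route x p n + (1, 0)) = 1"

lemma route_Suc: "route x p (Suc n) = route x p n + (if goes_right x p n then (1, 0) else (0, 1))"
  by (simp add: next_site_def goes_right_def)

lemma route_add: "route x p (m + n) = route x (route x p m) n"
  by (induction n) simp_all

lemma goes_right_add: "goes_right x p (m + n) = goes_right x (route x p m) n"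
  by (simp add: goes_right_def route_add)

lemma level_route: "level (route x p n) = level p + int n"
  by (induction n) (simp_all add: route_Suc level_def del: route.simps(2))

lemma site_rule: "x \<in> spaceX \<Longrightarrow> x p = x (p + (1, 0)) + x (p + (0, 1))"
  using spaceXD[of x "fst p" "snd p"] by (cases p) (simp only: plus_prod_def fst_conv snd_conv add_0_right)

lemma route_occupied:
  assumes "x \<in> spaceX" "x p = 1" shows "x (route x p n) = 1"
proof (induction n)
  case (Suc n)
  show ?case
    using site_rule[OF assms(1), of "route x p n"] Suc
    by (cases "x (route x p n + (1, 0))"; cases "x (route x p n + (0, 1))")
       (simp_all add: next_site_def)
qed (simp add: assms)

lemma route_local:
  assumes "\<And>s. level s \<le> level p + int n \<Longrightarrow> x s = y s"
  shows "route x p n = route y p n"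
  using assms
proof (induction n)
  case (Suc n)
  then have "route x p n = route y p n" by simp
  moreover have "x (route x p n + (1, 0)) = y (route x p n + (1, 0))"
  proof (rule Suc.prems)
    have "level (route x p n + (1, 0)) = level (route x p n) + 1" by (simp add: level_def)
    then show "level (route x p n + (1, 0)) \<le> level p + int (Suc n)"
      by (simp add: level_route)
  qed
  ultimately show ?case by (simp add: next_site_def)
qed simp

lemma goes_right_local:
  assumes "\<And>s. level s \<le> level p + int n + 1 \<Longrightarrow> x s = y s"
  shows "goes_right x p n = goes_right y p n"
proof -
  have "route x p n = route y p n" using assms by (intro route_local) simp
  moreover have "level (route x p n + (1, 0)) = level (route x p n) + 1" by (simp add: level_def)
  then have "x (route x p n + (1, 0)) = y (route x p n + (1, 0))"
    by (intro assms) (simp add: level_route)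
  ultimately show ?thesis by (simp add: goes_right_def)
qed

lemma fst_route_Suc: "fst (route x p (Suc n)) = fst (route x p n) + (if goes_right x p n then 1 else 0)"
  by (simp add: route_Suc del: route.simps(2))

lemma fst_route_bounds: "fst p \<le> fst (route x p n)" "fst (route x p n) \<le> fst p + int n"
  by (induction n) (auto simp: fst_route_Suc simp del: route.simps(2))

definition gap :: "config \<Rightarrow> int \<times> int \<Rightarrow> int \<times> int \<Rightarrow> nat \<Rightarrow> int" where
  "gap x p q n = fst (route x q n) - fst (route x p n)"

lemma gap_Suc: "gap x p q (Suc n) = gap x p q n + (if goes_right x q n then 1 else 0)
    - (if goes_right x p n then 1 else 0)"
  by (simp add: gap_def fst_route_Suc del: route.simps(2))

lemma gap_eq_0_iff:
  assumes "level p = level q" shows "gap x p q n = 0 \<longleftrightarrow> route x p n = route x q n"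
  using assms level_route[of x p n] level_route[of x q n]
  by (auto simp: gap_def level_def prod_eq_iff)

text \<open>
  Paths on the same row move by at most one unit relative to each other, and they stay together
  once they meet. So they cannot cross.
\<close>

lemma gap_nonneg:
  assumes "level p = level q" "fst p \<le> fst q" shows "0 \<le> gap x p q n"
proof (induction n)
  case (Suc n)
  show ?case
  proof (cases "gap x p q n = 0")
    case True
    then have "route x p n = route x q n" by (simp add: gap_eq_0_iff assms)
    then show ?thesis by (simp add: gap_def)
  next
    case False
    then show ?thesis using Suc by (simp add: gap_Suc)
  qed
qed (simp add: gap_def assms)

lemma merged_stays:
  assumes "route x p m = route x q m" "m \<le> n" shows "route x p n = route x q n"
  using route_add[of x p m "n - m"] route_add[of x q m "n - m"] assms by simp

text \<open>
  Above two adjacent ones there is a zero, and above two adjacent zeros there is a zero. A horizontal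
  run of ones therefore carries a triangle of zeros.
\<close>

lemma zeros_above_ones:
  assumes x: "x \<in> spaceX" and ones: "\<And>i. i \<le> N \<Longrightarrow> x (k + int i, l) = 1"
  shows "i + Suc j \<le> N \<Longrightarrow> x (k + int i, l + int (Suc j)) = 0"
proof (induction j arbitrary: i)
  case 0
  have "x (k + int i, l) = 1" "x (k + int i + 1, l) = 1"
    using ones[of i] ones[of "Suc i"] 0 by (simp_all add: ac_simps)
  with spaceXD[OF x, of "k + int i" l] show ?case
    by (cases "x (k + int i, l + 1)") simp_all
next
  case (Suc j)
  have "x (k + int i, l + int (Suc j)) = 0" "x (k + int i + 1, l + int (Suc j)) = 0"
    using Suc.IH[of i] Suc.IH[of "Suc i"] Suc.prems by (simp_all add: ac_simps)
  with spaceXD[OF x, of "k + int i" "l + int (Suc j)"]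
  have "x (k + int i, l + int (Suc j) + 1) = 0"
    by (cases "x (k + int i, l + int (Suc j) + 1)") simp_all
  then show ?case by (simp add: ac_simps)
qed

lemma route_of_right_run:
  assumes "\<And>i. i < N \<Longrightarrow> goes_right x p i" "n \<le> N"
  shows "route x p n = p + (int n, 0)"
  using assms(2)
proof (induction n)
  case 0
  show ?case by (simp add: prod_eq_iff)
next
  case (Suc n)
  then show ?case using assms(1)[of n] by (simp add: route_Suc prod_eq_iff del: route.simps(2))
qed

text \<open>
  If the distance did not shrink, the right path would also move right \<open>N\<close> times. The triangle of
  zeros above its run of ones is high enough to reach the horizontal line on which the left path runs,
  and it meets this line at an occupied site.
\<close>

lemma gap_shrinks:
  assumes x: "x \<in> spaceX" and occ: "x p = 1" "x q = 1"
    and lev: "level p = level q" and less: "fst p < fst q" "fst q \<le> fst p + int N"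
    and run: "\<And>i. i < N \<Longrightarrow> goes_right x p i"
  shows "gap x p q N < fst q - fst p"
proof (rule ccontr)
  assume "\<not> ?thesis"
  then have "fst q + int N \<le> fst (route x q N)"
    using route_of_right_run[OF run, of N] by (simp add: gap_def)
  have q_right: "goes_right x q i" if "i < N" for i
  proof (rule ccontr)
    assume "\<not> goes_right x q i"
    then have "fst (route x q (Suc i)) = fst (route x q i)" by (simp only: fst_route_Suc) simp
    moreover have "fst (route x q i) \<le> fst q + int i" by (rule fst_route_bounds)
    moreover have "fst (route x q N) \<le> fst (route x q (Suc i)) + int (N - Suc i)"
      using fst_route_bounds(2)[of x "route x q (Suc i)" "N - Suc i"] route_add[of x q "Suc i" "N - Suc i"] that
      by simp
    ultimately show False using \<open>fst q + int N \<le> _\<close> that by linarith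
  qed
  have ones: "x (fst s + int i, snd s) = 1" if "i \<le> N" "x s = 1" "\<And>i. i < N \<Longrightarrow> goes_right x s i" for s i
    using route_occupied[OF x that(2), of i] route_of_right_run[OF that(3,1)] by (simp add: plus_prod_def)
  define j where "j = nat (fst q - fst p) - 1"
  have j: "int (Suc j) = fst q - fst p" using less by (simp add: j_def)
  have "x (fst q + int 0, snd q + int (Suc j)) = 0"
    by (rule zeros_above_ones[OF x ones[OF _ occ(2) q_right]]) (use j less in auto)
  moreover have "snd q + int (Suc j) = snd p" using j lev by (simp add: level_def)
  moreover have "x (fst p + int (Suc j), snd p) = 1"
    by (rule ones[OF _ occ(1) run]) (use j less in auto)
  moreover have "fst p + int (Suc j) = fst q" using j by simp
  ultimately show False by simp
qed

text \<open>
  By \<open>gap_shrinks\<close>, each block of \<open>M\<close> right steps of the left path decreases the distance; induction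
  over the distance then needs \<open>M + (M - 1) + \<dots> + 1\<close> steps, which is at most \<open>M * M\<close>.
\<close>

lemma merge_after_right_run:
  assumes x: "x \<in> spaceX" and "x p = 1" "x q = 1" "level p = level q"
    and "fst p \<le> fst q" "fst q \<le> fst p + int M"
    and "\<And>i. i < M * M \<Longrightarrow> goes_right x p i"
  shows "route x p (M * M) = route x q (M * M)"
  using assms(2-)
proof (induction M arbitrary: p q)
  case 0
  then show ?case by (auto simp: level_def prod_eq_iff)
next
  case (Suc M)
  show ?case
  proof (cases "fst p = fst q")
    case True
    then have "p = q" using Suc.prems by (auto simp: level_def prod_eq_iff)
    then show ?thesis by simp
  next
    case False
    let ?p = "route x p (Suc M)" and ?q = "route x q (Suc M)"
    have run: "goes_right x p i" if "i < Suc M + M * M" for i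
      using Suc.prems(6)[of i] that by simp
    have "gap x p q (Suc M) < fst q - fst p"
      by (rule gap_shrinks) (use x Suc.prems False run in auto)
    then have "fst ?q \<le> fst ?p + int M"
      using Suc.prems by (simp add: gap_def del: route.simps(2))
    moreover have "fst ?p \<le> fst ?q"
      using gap_nonneg[of p q x "Suc M"] Suc.prems by (simp add: gap_def del: route.simps(2))
    moreover have "level ?p = level ?q"
      using Suc.prems by (simp only: level_route)
    moreover have "goes_right x ?p i" if "i < M * M" for i
    proof -
      have "goes_right x p (Suc M + i)" by (rule run) (use that in simp)
      then show ?thesis unfolding goes_right_add .
    qed
    moreover have "x ?p = 1" "x ?q = 1"
      by (rule route_occupied[OF x]; rule Suc.prems)+
    ultimately have "route x ?p (M * M) = route x ?q (M * M)"
      by (intro Suc.IH)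
    then have "route x p (Suc M + M * M) = route x q (Suc M + M * M)"
      by (simp only: route_add)
    then show ?thesis by (rule merged_stays) simp
  qed
qed

section \<open>Each step direction is a fair coin independent of the past\<close>

lemma route_measurable [measurable]: "(\<lambda>x. route x p n) \<in> borelX \<rightarrow>\<^sub>M count_space UNIV"
proof (induction n)
  case (Suc n)
  have "(\<lambda>x. next_site x s) \<in> borelX \<rightarrow>\<^sub>M count_space UNIV" for s
    unfolding next_site_def by measurable
  from measurable_compose_countable[OF this Suc] show ?case by simp
qed simp

lemma goes_right_measurable [measurable]: "Measurable.pred borelX (\<lambda>x. goes_right x p n)"
proof -
  have "(\<lambda>x. x (s + (1, 0))) \<in> borelX \<rightarrow>\<^sub>M count_space UNIV" for s by measurable
  then have [measurable]: "(\<lambda>x. x (route x p n + (1, 0))) \<in> borelX \<rightarrow>\<^sub>M count_space UNIV"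
    by (rule measurable_compose_countable[OF _ route_measurable])
  show ?thesis unfolding goes_right_def by measurable
qed

lemma gap_measurable [measurable]: "(\<lambda>x. gap x p q n) \<in> borelX \<rightarrow>\<^sub>M count_space UNIV"
  unfolding gap_def by measurable

text \<open>
  Translation by this point leaves the past up to row \<open>m\<close> unchanged and complements row \<open>m + 1\<close>.
\<close>

lemma ex_config_ones_on_level:
  "\<exists>a\<in>spaceX. (\<forall>s. level s \<le> m \<longrightarrow> a s = 0) \<and> (\<forall>s. level s = m + 1 \<longrightarrow> a s = 1)"
proof -
  obtain a where a: "a \<in> spaceX" "\<And>k. a (k, (m + 1) - k) = 1"
    using ex_config_with_row[of "m + 1" "\<lambda>_. 1"] by blast
  have top: "a s = 1" if "level s = m + 1" for s
  proof -
    have "s = (fst s, (m + 1) - fst s)" using that by (auto simp: level_def prod_eq_iff)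
    then show ?thesis using a(2)[of "fst s"] by simp
  qed
  have lev: "level (s + (1, 0)) = level s + 1" "level (s + (0, 1)) = level s + 1" for s
    by (simp_all add: level_def)
  have "a s = 0" if "level s = m - int n" for n s
    using that
  proof (induction n arbitrary: s)
    case 0
    then show ?case using site_rule[OF a(1), of s] by (simp add: top lev)
  next
    case (Suc n)
    then have "a (s + (1, 0)) = 0" "a (s + (0, 1)) = 0" by (simp_all add: lev)
    then show ?case using site_rule[OF a(1), of s] by simp
  qed
  then have "a s = 0" if "level s \<le> m" for s
    using that by (metis diff_diff_eq2 add_diff_cancel_left' nonneg_int_cases diff_ge_0_iff_ge)
  then show ?thesis using a(1) top by blast
qed

text \<open>
  These are the events of the filtration generated by the rows. A row
  determines all earlier rows, so agreement on all rows up to \<open>m\<close> amounts to agreement on row \<open>m\<close>.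
\<close>

definition decided_by :: "int \<Rightarrow> config set \<Rightarrow> bool" where
  "decided_by m D \<longleftrightarrow> D \<in> sets borelX \<and>
     (\<forall>x\<in>spaceX. \<forall>y\<in>spaceX. (\<forall>s. level s \<le> m \<longrightarrow> x s = y s) \<longrightarrow> (x \<in> D \<longleftrightarrow> y \<in> D))"

lemma decided_byD:
  assumes "decided_by m D" "x \<in> spaceX" "y \<in> spaceX" "\<And>s. level s \<le> m \<Longrightarrow> x s = y s"
  shows "x \<in> D \<longleftrightarrow> y \<in> D"
  using assms unfolding decided_by_def by blast

lemma decided_by_sets: "decided_by m D \<Longrightarrow> D \<in> sets borelX"
  unfolding decided_by_def by blast

lemma decided_byI:
  assumes "D \<in> sets borelX"
    and "\<And>x y. x \<in> spaceX \<Longrightarrow> y \<in> spaceX \<Longrightarrow> (\<And>s. level s \<le> m \<Longrightarrow> x s = y s) \<Longrightarrow> x \<in> D \<longleftrightarrow> y \<in> D"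
  shows "decided_by m D"
  unfolding decided_by_def using assms by blast

context haar_measure
begin

text \<open>
  The position after \<open>n\<close> steps depends only on the rows up to \<open>level p + n\<close>. Complementing the next row
  keeps the past and reverses the direction of the step.
\<close>

lemma prob_goes_right:
  assumes "decided_by (level p + int n) D"
  shows "prob (D \<inter> {x \<in> spaceX. goes_right x p n}) = prob D / 2"
proof -
  let ?m = "level p + int n"
  obtain a where a: "a \<in> spaceX" "\<And>s. level s \<le> ?m \<Longrightarrow> a s = 0" "\<And>s. level s = ?m + 1 \<Longrightarrow> a s = 1"
    using ex_config_ones_on_level[of ?m] by blast
  have same: "translate a x s = x s" if "level s \<le> ?m" for x s
    unfolding translate_apply a(2)[OF that] by (rule add_0)
  have D: "D \<in> events" using decided_by_sets[OF assms] by (simp add: sets_eq)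
  have "{x \<in> space borelX. goes_right x p n} \<in> sets borelX" by measurable
  then have R: "{x \<in> spaceX. goes_right x p n} \<in> events" by (simp add: sets_eq)
  show ?thesis
  proof (rule prob_flip[OF a(1) D R])
    fix x assume "x \<in> spaceX"
    then show "translate a x \<in> D \<longleftrightarrow> x \<in> D"
      by (intro decided_byD[OF assms] translate_in_spaceX a(1) same)
  next
    fix x assume "x \<in> D"
    then have x: "x \<in> spaceX" using sets.sets_into_space[OF D] by auto
    have route: "route (translate a x) p n = route x p n"
      by (rule route_local) (rule same)
    have "level (route x p n + (1, 0)) = ?m + 1"
      using level_route[of x p n] by (simp add: level_def)
    then have "goes_right (translate a x) p n \<longleftrightarrow> \<not> goes_right x p n"
      unfolding goes_right_def route translate_apply using a(3)
      by (cases "x (route x p n + (1, 0))") simp_all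
    then show "translate a x \<in> {x \<in> spaceX. goes_right x p n} \<longleftrightarrow> x \<notin> {x \<in> spaceX. goes_right x p n}"
      using x translate_in_spaceX[OF a(1) x] by simp
  qed
qed

lemma prob_right_run:
  assumes "decided_by (level p + int n) D"
  shows "prob (D \<inter> {x \<in> spaceX. \<forall>i<K. goes_right x p (n + i)}) = prob D / 2 ^ K"
proof -
  define E where "E K = D \<inter> {x \<in> spaceX. \<forall>i<K. goes_right x p (n + i)}" for K
  have sub: "D \<subseteq> spaceX"
    using sets.sets_into_space[OF decided_by_sets[OF assms]] by simp
  have E: "decided_by (level p + int (n + K)) (E K)" for K
  proof (rule decided_byI)
    have "{x \<in> space borelX. \<forall>i<K. goes_right x p (n + i)} \<in> sets borelX" by measurable
    then have "{x \<in> spaceX. \<forall>i<K. goes_right x p (n + i)} \<in> sets borelX"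
      unfolding space_borelX .
    with decided_by_sets[OF assms] show "E K \<in> sets borelX"
      unfolding E_def by (rule sets.Int)
  next
    fix x y assume xy: "x \<in> spaceX" "y \<in> spaceX"
      and same: "\<And>s. level s \<le> level p + int (n + K) \<Longrightarrow> x s = y s"
    have "goes_right x p (n + i) = goes_right y p (n + i)" if "i < K" for i
      by (rule goes_right_local) (use same that in auto)
    moreover have "x \<in> D \<longleftrightarrow> y \<in> D"
      by (rule decided_byD[OF assms xy]) (use same in simp)
    ultimately show "x \<in> E K \<longleftrightarrow> y \<in> E K"
      using xy by (auto simp: E_def)
  qed
  have "prob (E K) = prob D / 2 ^ K"
  proof (induction K)
    case 0
    have "E 0 = D" using sub by (auto simp: E_def)
    then show ?case by simp
  next
    case (Suc K)
    have "E (Suc K) = E K \<inter> {x \<in> spaceX. goes_right x p (n + K)}"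
      by (auto simp: E_def less_Suc_eq)
    then show ?case using prob_goes_right[OF E[of K]] Suc by simp
  qed
  then show ?thesis by (simp add: E_def)
qed

lemma decided_by_spaceX: "decided_by m spaceX"
  using sets.top[of borelX] by (simp add: decided_by_def)

lemma integrable_gap: "integrable \<mu> (\<lambda>x. real_of_int (gap x p q n))"
proof (rule integrable_const_bound[where B = "real_of_int (\<bar>fst q - fst p\<bar> + int n)"])
  have "\<bar>gap x p q n\<bar> \<le> \<bar>fst q - fst p\<bar> + int n" for x
    using fst_route_bounds[where x = x and p = p and n = n]
      fst_route_bounds[where x = x and p = q and n = n]
    unfolding gap_def by linarith
  then show "AE x in \<mu>. norm (real_of_int (gap x p q n)) \<le> real_of_int (\<bar>fst q - fst p\<bar> + int n)"
    by (intro AE_I2) (simp only: real_norm_def of_int_abs[symmetric] of_int_le_iff)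
  have "(\<lambda>x. real_of_int (gap x p q n)) \<in> borelX \<rightarrow>\<^sub>M borel" by measurable
  then show "(\<lambda>x. real_of_int (gap x p q n)) \<in> \<mu> \<rightarrow>\<^sub>M borel" by (simp only: measurable_eq)
qed

text \<open>
  The distance changes by the difference of two direction bits, and each of them has mean \<open>1/2\<close>, although
  the two need not be independent.
\<close>

lemma expectation_gap:
  assumes "level p = level q"
  shows "expectation (\<lambda>x. real_of_int (gap x p q n)) = fst q - fst p"
proof (induction n)
  case 0
  show ?case using prob_space by (simp add: gap_def)
next
  case (Suc n)
  let ?R = "\<lambda>s. {x \<in> spaceX. goes_right x s n}"
  have "{x \<in> space borelX. goes_right x s n} \<in> sets borelX" for s by measurable
  then have R: "?R s \<in> events" for s by (simp add: sets_eq)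
  have half: "prob (?R s) = 1/2" for s
    using prob_goes_right[OF decided_by_spaceX, of s n] prob_space by (simp add: Int_absorb1)
  have "expectation (\<lambda>x. real_of_int (gap x p q (Suc n)))
      = expectation (\<lambda>x. real_of_int (gap x p q n) + indicator (?R q) x - indicator (?R p) x)"
    by (rule Bochner_Integration.integral_cong) (simp_all add: gap_Suc indicator_def)
  also have "\<dots> = expectation (\<lambda>x. real_of_int (gap x p q n)) + prob (?R q) - prob (?R p)"
    using R integrable_gap by (simp add: emeasure_eq_measure Int_absorb2)
  finally show ?case using Suc half by simp
qed

lemma prob_gap_ge:
  assumes "level p = level q" "fst p \<le> fst q" "M > 0"
  shows "prob {x \<in> spaceX. real M \<le> gap x p q n} \<le> real_of_int (fst q - fst p) / M"
  using integral_Markov_inequality_measure[OF integrable_gap[of p q n], of "{}" "real M"]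
    gap_nonneg[OF assms(1,2)] assms(3) expectation_gap[OF assms(1), of n]
  by (simp add: field_simps)

section \<open>Almost surely all paths merge\<close>

text \<open>
  Suppose that the paths have not merged after \<open>n\<close> steps. If their distance is less than \<open>M\<close>, they
  merge within \<open>M * M\<close> further steps with conditional probability at least \<open>1 / 2 ^ (M * M)\<close>; a larger
  distance has probability at most \<open>d / M\<close>, where \<open>d\<close> is the initial one. Passing to the limit in \<open>n\<close> and then in \<open>M\<close> makes the probability of
  never merging vanish.
\<close>

lemma prob_never_merge:
  assumes lev: "level p = level q" and le: "fst p \<le> fst q"
  shows "prob {x \<in> spaceX. x p = 1 \<and> x q = 1 \<and> (\<forall>n. route x p n \<noteq> route x q n)} = 0"
proof -
  define A where "A n = {x \<in> spaceX. x p = 1 \<and> x q = 1 \<and> route x p n \<noteq> route x q n}" for n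
  define u where "u n = prob (A n)" for n
  define d where "d = real_of_int (fst q - fst p)"
  have "{x \<in> space borelX. x p = 1 \<and> x q = 1 \<and> route x p n \<noteq> route x q n} \<in> sets borelX" for n
    by measurable
  then have A: "A n \<in> sets borelX" for n by (simp add: A_def)
  have anti: "A n \<subseteq> A m" if "m \<le> n" for m n
    unfolding A_def by (intro Collect_mono impI) (use merged_stays[OF _ that] in blast)
  have drop: "u (n + M * M) \<le> u n - (u n - d / M) / 2 ^ (M * M)" if "M > 0" for n M
  proof -
    define D where "D = A n \<inter> {x \<in> spaceX. gap x p q n < int M}"
    define R where "R = D \<inter> {x \<in> spaceX. \<forall>i<M * M. goes_right x p (n + i)}"
    have "{x \<in> space borelX. gap x p q n < int M} \<in> sets borelX" by measurable
    then have D: "D \<in> sets borelX" using A by (simp add: D_def)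
    have "decided_by (level p + int n) D"
    proof (rule decided_byI)
      fix x y assume xy: "x \<in> spaceX" "y \<in> spaceX"
        and same: "\<And>s. level s \<le> level p + int n \<Longrightarrow> x s = y s"
      have "route x p n = route y p n" "route x q n = route y q n"
        by (rule route_local; use same lev in simp)+
      moreover have "x p = y p" "x q = y q" using same lev by auto
      ultimately show "x \<in> D \<longleftrightarrow> y \<in> D"
        using xy by (simp add: D_def A_def gap_def)
    qed (rule D)
    then have prob_R: "prob R = prob D / 2 ^ (M * M)"
      unfolding R_def by (rule prob_right_run)
    define G where "G = {x \<in> spaceX. real M \<le> gap x p q n}"
    have "{x \<in> space borelX. real M \<le> gap x p q n} \<in> sets borelX" by measurable
    then have G: "G \<in> sets borelX" by (simp only: G_def space_borelX)
    have "A n \<subseteq> D \<union> G"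
      by (auto simp: D_def A_def G_def)
    then have "u n \<le> prob (D \<union> G)"
      unfolding u_def by (rule finite_measure_mono) (simp add: sets_eq D G sets.Un)
    also have "\<dots> \<le> prob D + prob G"
      by (rule measure_Un_le) (simp_all add: sets_eq D G)
    also have "\<dots> \<le> prob D + d / M"
      using prob_gap_ge[OF lev le that, of n] by (simp add: d_def G_def)
    finally have "(u n - d / M) / 2 ^ (M * M) \<le> prob R"
      unfolding prob_R by (intro divide_right_mono) simp_all
    also have "R \<subseteq> A n - A (n + M * M)"
    proof
      fix x assume x: "x \<in> R"
      then have xA: "x \<in> spaceX" "x p = 1" "x q = 1" and less: "gap x p q n < int M"
        and run: "\<forall>i<M * M. goes_right x p (n + i)"
        unfolding R_def D_def A_def by blast+
      have "route x (route x p n) (M * M) = route x (route x q n) (M * M)"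
      proof (rule merge_after_right_run)
        show "level (route x p n) = level (route x q n)" by (simp add: level_route lev)
        show "fst (route x p n) \<le> fst (route x q n)"
          using gap_nonneg[OF lev le, of x n] by (simp add: gap_def)
        show "fst (route x q n) \<le> fst (route x p n) + int M"
          using less by (simp add: gap_def)
        show "goes_right x (route x p n) i" if "i < M * M" for i
          using run that unfolding goes_right_add by blast
      qed (rule xA(1) route_occupied[OF xA(1,2)] route_occupied[OF xA(1,3)])+
      then show "x \<in> A n - A (n + M * M)"
        using x by (simp add: R_def D_def A_def route_add)
    qed
    then have "prob R \<le> prob (A n - A (n + M * M))"
      by (rule finite_measure_mono) (simp add: A sets_eq sets.Diff)
    also have "\<dots> = u n - u (n + M * M)"
      unfolding u_def by (rule finite_measure_Diff) (simp_all add: A sets_eq anti)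
    finally show ?thesis by simp
  qed
  have "decseq u"
    unfolding decseq_def u_def by (auto intro!: finite_measure_mono anti simp: A sets_eq)
  moreover have "u n \<ge> 0" for n by (simp add: u_def)
  ultimately obtain L where L: "u \<longlonglongrightarrow> L"
    using decseq_convergent[of u 0] by blast
  have L_le: "L \<le> d / M" if "M > 0" for M :: nat
  proof -
    have "(\<lambda>n. u (n + M * M)) \<longlonglongrightarrow> L" by (rule LIMSEQ_ignore_initial_segment[OF L])
    moreover have "(\<lambda>n. u n - (u n - d / M) / 2 ^ (M * M)) \<longlonglongrightarrow> L - (L - d / M) / 2 ^ (M * M)"
      by (intro tendsto_intros L) simp
    ultimately have "L \<le> L - (L - d / M) / 2 ^ (M * M)"
      by (rule LIMSEQ_le) (use drop[OF that] in auto)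
    then have "\<not> 0 < (L - d / M) / 2 ^ (M * M)" by simp
    moreover have "0 < (L - d / M) / 2 ^ (M * M)" if "d / M < L"
      using that by (intro divide_pos_pos) simp_all
    ultimately show ?thesis by linarith
  qed
  have "(\<lambda>n. d / real (Suc n)) \<longlonglongrightarrow> 0" by (rule tendsto_mult_right_zero[OF LIMSEQ_inverse_real_of_nat, unfolded divide_inverse[symmetric]])
  then have "L \<le> 0"
    by (rule LIMSEQ_le_const) (intro exI allI impI L_le, simp)
  have N: "{x \<in> space borelX. x p = 1 \<and> x q = 1 \<and> (\<forall>n. route x p n \<noteq> route x q n)} \<in> sets borelX"
    by measurable
  have "prob {x \<in> spaceX. x p = 1 \<and> x q = 1 \<and> (\<forall>n. route x p n \<noteq> route x q n)} \<le> u n" for n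
    unfolding u_def by (rule finite_measure_mono) (auto simp: A_def A[unfolded A_def] sets_eq)
  then have "prob {x \<in> spaceX. x p = 1 \<and> x q = 1 \<and> (\<forall>n. route x p n \<noteq> route x q n)} \<le> L"
    by (intro LIMSEQ_le_const[OF L]) auto
  with \<open>L \<le> 0\<close> show ?thesis
    by (intro antisym) simp_all
qed

end

section \<open>From paths to the map \<sigma>\<close>

lemma next_site_act: "next_site (act v x) p + v = next_site x (p + v)"
  by (simp add: next_site_def act_site ac_simps)

lemma route_act: "route (act v x) p n + v = route x (p + v) n"
  by (induction n) (simp_all add: next_site_act)

lemma act_in_setY_iff: "x \<in> spaceX \<Longrightarrow> act p x \<in> setY \<longleftrightarrow> x p = 1"
  by (cases p) (simp add: setY_def act_in_spaceX act_site)

lemma sigmaY_act: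
  assumes "x \<in> spaceX"
  shows "sigmaY (act p x) = act (next_site x p) x"
proof -
  have "shiftT (act p x) = act (p + (1, 0)) x" "shiftS (act p x) = act (p + (0, 1)) x"
    by (simp_all only: shiftT_eq_act shiftS_eq_act act_add add.commute)
  then show ?thesis
    using act_in_setY_iff[OF assms] by (simp add: sigmaY_def next_site_def)
qed

text \<open>
  Seen from its origin, a configuration moves under \<open>\<sigma>\<close> by following the path of the origin.
\<close>

lemma sigmaY_funpow_act:
  assumes "x \<in> spaceX"
  shows "(sigmaY ^^ n) (act p x) = act (route x p n) x"
  by (induction n) (simp_all add: sigmaY_act[OF assms])

lemma sigmaY_funpow_in_setY: "x \<in> setY \<Longrightarrow> (sigmaY ^^ n) x \<in> setY"
  by (induction n) (simp_all add: sigmaY_in_setY)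

definition merging :: "config set" where
  "merging = {x \<in> spaceX. \<forall>p q. x p = 1 \<longrightarrow> x q = 1 \<longrightarrow> (\<exists>m n. route x p m = route x q n)}"

lemma merging_sets: "merging \<in> sets borelX"
proof -
  have "{x \<in> space borelX. \<forall>p q. x p = 1 \<longrightarrow> x q = 1 \<longrightarrow> (\<exists>m n. route x p m = route x q n)} \<in> sets borelX"
    by measurable
  then show ?thesis by (simp add: merging_def)
qed

lemma mergingD:
  "x \<in> merging \<Longrightarrow> x p = 1 \<Longrightarrow> x q = 1 \<Longrightarrow> \<exists>m n. route x p m = route x q n"
  unfolding merging_def by blast

lemma act_merging: "x \<in> merging \<Longrightarrow> act v x \<in> merging"
proof -
  assume x: "x \<in> merging"
  have "\<exists>m n. route (act v x) p m = route (act v x) q n" if occ: "act v x p = 1" "act v x q = 1" for p q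
  proof -
    obtain m n where "route x (p + v) m = route x (q + v) n"
      using mergingD[OF x] occ unfolding act_site by blast
    then have "route (act v x) p m + v = route (act v x) q n + v"
      by (simp only: route_act)
    then show ?thesis by auto
  qed
  moreover have "act v x \<in> spaceX" using x by (simp add: merging_def act_in_spaceX)
  ultimately show ?thesis unfolding merging_def by blast
qed

lemma invariant_merging: "invariant_set merging"
  unfolding invariant_set_def
proof (intro allI equalityI)
  fix v show "act v ` merging \<subseteq> merging" using act_merging by blast
  show "merging \<subseteq> act v ` merging"
  proof
    fix x assume "x \<in> merging"
    then have "act (- v) x \<in> merging" by (rule act_merging)
    moreover have "x = act v (act (- v) x)"
      by (simp add: act_add act_zero zero_prod_def)
    ultimately show "x \<in> act v ` merging" by blast
  qed
qed

lemma orbit_subset_sigma_component: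
  assumes "x \<in> setY" "x \<in> merging"
  shows "orbit x \<inter> setY \<subseteq> sigma_component x"
proof
  fix y assume y: "y \<in> orbit x \<inter> setY"
  then obtain v where v: "y = act v x" by (auto simp: orbit_def)
  have x: "x \<in> spaceX" and "x (0, 0) = 1" using assms by (auto simp: setY_def)
  moreover have "x v = 1" using y v act_in_setY_iff[OF x] by simp
  ultimately obtain m n where "route x (0, 0) m = route x v n"
    using mergingD[OF assms(2)] by blast
  then have "(sigmaY ^^ m) (act (0, 0) x) = (sigmaY ^^ n) (act v x)"
    by (simp add: sigmaY_funpow_act[OF x])
  then have "(sigmaY ^^ m) x = (sigmaY ^^ n) y" by (simp add: act_zero v)
  then show "y \<in> sigma_component x" using y unfolding sigma_component_def by blast
qed

context haar_measure
begin

text \<open>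
  Two arbitrary sites reduce to two sites on one row by first following the path of the lower one. There
  are only countably many pairs of sites.
\<close>

lemma AE_merging: "AE x in \<mu>. x \<in> merging"
proof -
  let ?N = "\<lambda>p q x. x p = 1 \<and> x q = 1 \<and> (\<forall>n. route x p n \<noteq> route x q n)"
  have "AE x in \<mu>. level p = level q \<longrightarrow> fst p \<le> fst q \<longrightarrow> \<not> ?N p q x" for p q
  proof (cases "level p = level q \<and> fst p \<le> fst q")
    case True
    have "{x \<in> space borelX. ?N p q x} \<in> sets borelX" by measurable
    then have "{x \<in> spaceX. ?N p q x} \<in> null_sets \<mu>"
      using prob_never_merge[of p q] True by (auto simp: null_sets_def emeasure_eq_measure sets_eq)
    then have "AE x in \<mu>. x \<notin> {x \<in> spaceX. ?N p q x}" by (rule AE_not_in)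
    then show ?thesis using AE_space by eventually_elim auto
  qed auto
  then have "AE x in \<mu>. \<forall>p q. level p = level q \<longrightarrow> fst p \<le> fst q \<longrightarrow> \<not> ?N p q x"
    by (intro AE_all_countable[THEN iffD2] allI)
  then show ?thesis using AE_space
  proof eventually_elim
    fix x assume H: "\<forall>p q. level p = level q \<longrightarrow> fst p \<le> fst q \<longrightarrow> \<not> ?N p q x" and "x \<in> space \<mu>"
    then have X: "x \<in> spaceX" by simp
    have same: "\<exists>n. route x p n = route x q n" if "x p = 1" "x q = 1" "level p = level q" for p q
    proof (cases "fst p \<le> fst q")
      case True
      then show ?thesis using H that by blast
    next
      case False
      then have "\<exists>n. route x q n = route x p n" using H that by (metis linear)
      then show ?thesis by metis
    qed
    have ordered: "\<exists>m n. route x p m = route x q n" if occ: "x p = 1" "x q = 1" "level p \<le> level q" for p q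
    proof -
      let ?p = "route x p (nat (level q - level p))"
      have "level ?p = level q" using occ by (simp add: level_route)
      then obtain n where "route x ?p n = route x q n"
        using same[OF route_occupied[OF X occ(1)] occ(2)] by blast
      then have "route x p (nat (level q - level p) + n) = route x q n" by (simp only: route_add)
      then show ?thesis by blast
    qed
    show "x \<in> merging"
      unfolding merging_def
    proof (intro CollectI conjI allI impI X)
      fix p q assume occ: "x p = 1" "x q = 1"
      show "\<exists>m n. route x p m = route x q n"
      proof (cases "level p \<le> level q")
        case True then show ?thesis using ordered[OF occ] by blast
      next
        case False
        then have "\<exists>m n. route x q m = route x p n" using ordered[OF occ(2,1)] by simp
        then show ?thesis by metis
      qed
    qed
  qed
qed

lemma emeasure_merging: "emeasure \<mu> merging = 1"
  using AE_merging merging_sets prob_eq_1[of merging] by (simp add: emeasure_eq_measure sets_eq)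

end

section \<open>Points with infinitely many antecedents\<close>

text \<open>
  The antecedents of \<open>x\<close> lie in its countable orbit, so they can be indexed by sites. Different sites may
  give the same antecedent when \<open>x\<close> has periods; hence the condition that the path leads
  back to the configuration \<open>x\<close> and not to the origin.
\<close>

definition ancestor_at :: "int \<times> int \<Rightarrow> config \<Rightarrow> bool" where
  "ancestor_at p x \<longleftrightarrow> x p = 1 \<and> (\<exists>n\<ge>1. act (route x p n) x = x)"

lemma sigma_antecedents_eq:
  assumes "x \<in> setY"
  shows "sigma_antecedents x = (\<lambda>p. act p x) ` {p. ancestor_at p x}"
proof (intro equalityI subsetI)
  have x: "x \<in> spaceX" "x (0, 0) = 1" using assms by (auto simp: setY_def)
  {
    fix y assume "y \<in> sigma_antecedents x"
    then obtain n where y: "y \<in> setY" and n: "n \<ge> 1" "(sigmaY ^^ n) y = x"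
      by (auto simp: sigma_antecedents_def)
    then have yX: "y \<in> spaceX" by (simp add: setY_def)
    define w where "w = route y (0, 0) n"
    have "act w y = x"
      using sigmaY_funpow_act[OF yX, of n "(0, 0)"] n by (simp add: act_zero w_def)
    then have y_eq: "y = act (- w) x"
      by (auto simp: act_add act_zero zero_prod_def)
    have "x (- w) = 1" using y act_in_setY_iff[OF x(1)] y_eq by simp
    moreover have "act (route x (- w) n) x = x"
      using sigmaY_funpow_act[OF x(1), of n "- w"] n y_eq by simp
    ultimately show "y \<in> (\<lambda>p. act p x) ` {p. ancestor_at p x}"
      using n y_eq by (auto simp: ancestor_at_def)
  }
  fix y assume "y \<in> (\<lambda>p. act p x) ` {p. ancestor_at p x}"
  then obtain p n where "y = act p x" "x p = 1" "n \<ge> 1" "act (route x p n) x = x"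
    by (auto simp: ancestor_at_def)
  then show "y \<in> sigma_antecedents x"
    using sigmaY_funpow_act[OF x(1), of n p] act_in_setY_iff[OF x(1)]
    by (auto simp: sigma_antecedents_def)
qed

text \<open>
  Lists over a countable type are countable, so this reformulation expresses the infinity of a set
  of antecedents by countable operations.
\<close>

lemma infinite_image_iff_distinct_lists:
  "infinite (f ` A) \<longleftrightarrow> (\<forall>m. \<exists>ps. length ps = m \<and> distinct (map f ps) \<and> set ps \<subseteq> A)"
proof
  assume inf: "infinite (f ` A)"
  show "\<forall>m. \<exists>ps. length ps = m \<and> distinct (map f ps) \<and> set ps \<subseteq> A"
  proof
    fix m
    obtain F where F: "finite F" "card F = m" "F \<subseteq> f ` A"
      using infinite_arbitrarily_large[OF inf] by blast
    then obtain P where P: "P \<subseteq> A" "finite P" "F = f ` P" "inj_on f P"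
      by (metis finite_imageD subset_image_inj)
    obtain ps where "set ps = P" "distinct ps" using finite_distinct_list[OF P(2)] by blast
    with F P show "\<exists>ps. length ps = m \<and> distinct (map f ps) \<and> set ps \<subseteq> A"
      by (intro exI[of _ ps]) (auto simp: distinct_map card_image distinct_card)
  qed
next
  assume lists: "\<forall>m. \<exists>ps. length ps = m \<and> distinct (map f ps) \<and> set ps \<subseteq> A"
  show "infinite (f ` A)"
  proof
    assume fin: "finite (f ` A)"
    obtain ps where ps: "length ps = Suc (card (f ` A))" "distinct (map f ps)" "set ps \<subseteq> A"
      using lists by blast
    have "card (set (map f ps)) \<le> card (f ` A)"
      by (rule card_mono[OF fin]) (use ps in auto)
    then show False using distinct_card[OF ps(2)] ps(1) by simp
  qed
qed

lemma setZ_sets: "setZ \<in> sets borelX"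
proof -
  have "(\<lambda>x. act (route x p n) x) \<in> borelX \<rightarrow>\<^sub>M borelX" for p n
    by (rule measurable_compose_countable[OF measurable_act route_measurable])
  then have "Measurable.pred borelX (\<lambda>x. act (route x p n) x = x)" for p n
    by (rule pred_eq_config) simp
  then have [measurable]: "Measurable.pred borelX (\<lambda>x. ancestor_at p x)" for p
    unfolding ancestor_at_def by measurable
  have [measurable]: "Measurable.pred borelX (\<lambda>x. act p x = act q x)" for p q
    by (rule pred_eq_config) simp_all
  have [measurable]: "Measurable.pred borelX (\<lambda>x. distinct (map (\<lambda>p. act p x) ps))" for ps
    by (induction ps) (simp_all add: image_iff)
  have anc: "(\<forall>p\<in>set ps. ancestor_at p x) \<longleftrightarrow> set ps \<subseteq> {p. ancestor_at p x}" for ps x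
    by blast
  have "{x \<in> space borelX. x (0, 0) = 1 \<and>
      (\<forall>m. \<exists>ps. length ps = m \<and> distinct (map (\<lambda>p. act p x) ps) \<and> (\<forall>p\<in>set ps. ancestor_at p x))} \<in> sets borelX"
    by measurable
  also have "{x \<in> space borelX. x (0, 0) = 1 \<and>
      (\<forall>m. \<exists>ps. length ps = m \<and> distinct (map (\<lambda>p. act p x) ps) \<and> (\<forall>p\<in>set ps. ancestor_at p x))}
    = {x \<in> setY. \<forall>m. \<exists>ps. length ps = m \<and> distinct (map (\<lambda>p. act p x) ps) \<and> set ps \<subseteq> {p. ancestor_at p x}}"
    unfolding setY_def space_borelX anc by blast
  also have "\<dots> = setZ"
    unfolding setZ_def
    by (intro Collect_cong conj_cong refl) (simp only: sigma_antecedents_eq infinite_image_iff_distinct_lists)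
  finally show ?thesis .
qed

lemma setZ_forward: "z \<in> setZ \<Longrightarrow> sigmaY z \<in> setZ"
proof -
  assume z: "z \<in> setZ"
  have "sigma_antecedents z \<subseteq> sigma_antecedents (sigmaY z)"
  proof
    fix y assume "y \<in> sigma_antecedents z"
    then obtain n where "y \<in> setY" "(sigmaY ^^ n) y = z"
      by (auto simp: sigma_antecedents_def)
    then have "y \<in> setY" "(sigmaY ^^ Suc n) y = sigmaY z" "Suc n \<ge> 1" by auto
    then show "y \<in> sigma_antecedents (sigmaY z)"
      unfolding sigma_antecedents_def by blast
  qed
  with z show ?thesis by (auto simp: setZ_def sigmaY_in_setY dest: finite_subset)
qed

lemma sigmaY_preimage:
  assumes "y \<in> setY"
  shows "y = (if shiftT y \<in> setY then act (-1, 0) (sigmaY y) else act (0, -1) (sigmaY y))"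
  by (simp add: sigmaY_def shiftT_eq_act shiftS_eq_act act_act act_zero)

text \<open>
  As in Koenig's lemma: a point has at most two preimages, so one of them inherits the infinity
  of antecedents.
\<close>

lemma setZ_backward:
  assumes "x \<in> setZ"
  shows "\<exists>y\<in>setZ. sigmaY y = x"
proof (rule ccontr)
  assume none: "\<not> ?thesis"
  define P where "P = {y \<in> setY. sigmaY y = x}"
  have "P \<subseteq> {act (-1, 0) x, act (0, -1) x}"
  proof
    fix y assume "y \<in> P"
    then show "y \<in> {act (-1, 0) x, act (0, -1) x}"
      using sigmaY_preimage[of y] by (auto simp: P_def split: if_splits)
  qed
  then have "finite P" by (rule finite_subset) simp
  moreover have "finite (sigma_antecedents y)" if "y \<in> P" for y
    using that none by (auto simp: P_def setZ_def)
  ultimately have "finite (\<Union>y\<in>P. insert y (sigma_antecedents y))" by auto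
  moreover have "sigma_antecedents x \<subseteq> (\<Union>y\<in>P. insert y (sigma_antecedents y))"
  proof
    fix y assume "y \<in> sigma_antecedents x"
    then obtain n where y: "y \<in> setY" "(sigmaY ^^ Suc n) y = x"
      by (auto simp: sigma_antecedents_def Suc_le_eq gr0_conv_Suc)
    define z where "z = (sigmaY ^^ n) y"
    have "z \<in> P" using y sigmaY_funpow_in_setY[OF y(1), of n] by (simp add: z_def P_def)
    moreover have "y \<in> insert z (sigma_antecedents z)"
    proof (cases "n = 0")
      case False
      then show ?thesis using y(1) by (auto simp: sigma_antecedents_def z_def intro!: exI[of _ n])
    qed (simp add: z_def)
    ultimately show "y \<in> (\<Union>y\<in>P. insert y (sigma_antecedents y))" by blast
  qed
  ultimately show False using assms by (auto simp: setZ_def dest: finite_subset)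
qed

text \<open>
  These two sets are the images under \<open>\<sigma>\<close> of the parts of \<open>Z\<close> on which \<open>\<sigma>\<close> is \<open>T\<close> and \<open>S\<close>.
\<close>

definition via_right :: "config set" where
  "via_right = {x \<in> spaceX. act (-1, 0) x \<in> {z \<in> setZ. shiftT z \<in> setY}}"

definition via_up :: "config set" where
  "via_up = {x \<in> spaceX. act (0, -1) x \<in> {z \<in> setZ. shiftT z \<notin> setY}}"

lemma setZ_subset_via: "setZ \<subseteq> via_right \<union> via_up"
proof
  fix x assume x: "x \<in> setZ"
  then obtain y where y: "y \<in> setZ" "sigmaY y = x" using setZ_backward by blast
  then have "y \<in> setY" by (simp add: setZ_def)
  moreover have "x \<in> spaceX" using x by (simp add: setZ_def setY_def)
  ultimately show "x \<in> via_right \<union> via_up"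
    using y sigmaY_preimage[of y] by (cases "shiftT y \<in> setY") (auto simp: via_right_def via_up_def)
qed

lemma setZ_route:
  assumes "x \<in> spaceX" "act p x \<in> setZ"
  shows "act (route x p n) x \<in> setZ"
proof (induction n)
  case (Suc n)
  then show ?case using setZ_forward sigmaY_act[OF assms(1), of "route x p n"] by fastforce
qed (simp add: assms)

text \<open>
  Two paths through \<open>Z\<close> that start on one row must merge. At the first common site they arrive from the
  left and from below, which makes this site a branching point of \<open>Z\<close>.
\<close>

lemma setZ_sites_on_level_unique:
  assumes x: "x \<in> merging" and nobranch: "\<And>v. act v x \<notin> via_right \<inter> via_up"
    and Z: "act p x \<in> setZ" "act q x \<in> setZ" and lev: "level p = level q"
  shows "p = q"
proof (rule ccontr)
  assume "p \<noteq> q"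
  have X: "x \<in> spaceX" using x by (simp add: merging_def)
  have "x p = 1" "x q = 1" using Z act_in_setY_iff[OF X] by (auto simp: setZ_def)
  then obtain m n where mn: "route x p m = route x q n"
    using mergingD[OF x] by blast
  then have "m = n" using level_route[of x p m] level_route[of x q n] lev by simp
  with mn have ex: "route x p n = route x q n" by simp
  define k where "k = (LEAST k. route x p k = route x q k)"
  have k: "route x p k = route x q k" unfolding k_def by (rule LeastI[of "\<lambda>k. route x p k = route x q k", OF ex])
  have "k \<noteq> 0" using k \<open>p \<noteq> q\<close> by (cases k) auto
  then obtain j where j: "k = Suc j" by (cases k) auto
  let ?s = "route x p j" and ?t = "route x q j"
  have st: "?s \<noteq> ?t" using not_less_Least[of j "\<lambda>k. route x p k = route x q k"] j by (simp add: k_def)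
  have next_eq: "next_site x ?s = next_site x ?t" using k j by simp
  have Zst: "act ?s x \<in> setZ" "act ?t x \<in> setZ" using setZ_route[OF X] Z by auto
  have branch: False
    if s: "act s x \<in> setZ" "x (s + (1, 0)) = 1" and t: "act t x \<in> setZ" "x (t + (1, 0)) \<noteq> 1"
      and r: "s + (1, 0) = t + (0, 1)" for s t
  proof -
    have T: "shiftT (act v x) \<in> setY \<longleftrightarrow> x (v + (1, 0)) = 1" for v
      using act_in_setY_iff[OF X, of "v + (1, 0)"] by (simp add: shiftT_eq_act act_add add.commute)
    have "act (-1, 0) (act (s + (1, 0)) x) = act s x" "act (0, -1) (act (t + (0, 1)) x) = act t x"
      by (simp_all add: act_add plus_prod_def)
    then have "act (s + (1, 0)) x \<in> via_right" "act (t + (0, 1)) x \<in> via_up"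
      using s t T X by (auto simp: via_right_def via_up_def act_in_spaceX)
    then show False using nobranch[of "s + (1, 0)"] r by simp
  qed
  show False
  proof (cases "x (?s + (1, 0)) = 1"; cases "x (?t + (1, 0)) = 1")
    assume "x (?s + (1, 0)) = 1" "x (?t + (1, 0)) = 1"
    then show False using next_eq st unfolding next_site_def by simp
  next
    assume *: "x (?s + (1, 0)) = 1" "x (?t + (1, 0)) \<noteq> 1"
    then have "?s + (1, 0) = ?t + (0, 1)" using next_eq unfolding next_site_def by simp
    then show False by (rule branch[OF Zst(1) *(1) Zst(2) *(2)])
  next
    assume *: "x (?s + (1, 0)) \<noteq> 1" "x (?t + (1, 0)) = 1"
    then have "?t + (1, 0) = ?s + (0, 1)" using next_eq unfolding next_site_def by simp
    then show False by (rule branch[OF Zst(2) *(2) Zst(1) *(1)])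
  next
    assume "x (?s + (1, 0)) \<noteq> 1" "x (?t + (1, 0)) \<noteq> 1"
    then show False using next_eq st unfolding next_site_def by simp
  qed
qed

context haar_measure
begin

lemma AE_act:
  assumes "A \<in> events" "prob A = 0"
  shows "AE x in \<mu>. \<forall>v. act v x \<notin> A"
proof (subst AE_all_countable, rule allI)
  fix v
  have "{x \<in> spaceX. act v x \<in> A} \<in> null_sets \<mu>"
    using prob_act[OF assms(1), of v] act_vimage_events[OF assms(1), of v] assms(2)
    by (auto simp: null_sets_def emeasure_eq_measure)
  from AE_not_in[OF this] AE_space show "AE x in \<mu>. act v x \<notin> A"
    by eventually_elim auto
qed

text \<open>
  The two pieces of \<open>\<sigma>\<close> preserve the measure, so the images of the two parts of \<open>Z\<close> have total measure
  equal to that of \<open>Z\<close>. As they cover \<open>Z\<close>, their overlap is null.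
\<close>

lemma prob_via_both: "via_right \<inter> via_up \<in> events \<and> prob (via_right \<inter> via_up) = 0"
proof -
  let ?R = "{z \<in> setZ. shiftT z \<in> setY}" and ?U = "{z \<in> setZ. shiftT z \<notin> setY}"
  have Z: "setZ \<in> events" by (simp add: setZ_sets sets_eq)
  have "{z \<in> space borelX. z (1, 0) = 1} \<in> sets borelX" by measurable
  then have T: "{z \<in> spaceX. z (1, 0) = 1} \<in> events" by (simp add: sets_eq)
  have shift: "shiftT z \<in> setY \<longleftrightarrow> z (1, 0) = 1" if "z \<in> spaceX" for z
    using act_in_setY_iff[OF that, of "(1, 0)"] by (simp add: shiftT_eq_act)
  have ZX: "setZ \<subseteq> spaceX" by (auto simp: setZ_def setY_def)
  have "?R = setZ \<inter> {z \<in> spaceX. z (1, 0) = 1}" "?U = setZ - {z \<in> spaceX. z (1, 0) = 1}"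
    using ZX shift by auto
  then have RU: "?R \<in> events" "?U \<in> events" using Z T by auto
  have via: "via_right \<in> events" "via_up \<in> events"
    unfolding via_right_def via_up_def by (intro act_vimage_events RU)+
  have "prob (via_right \<union> via_up) = prob via_right + prob via_up - prob (via_right \<inter> via_up)"
    using measure_Un3[of via_right \<mu> via_up] via by (simp add: fmeasurable_eq_sets)
  moreover have "prob via_right = prob ?R" "prob via_up = prob ?U"
    unfolding via_right_def via_up_def by (intro prob_act RU)+
  moreover have "prob setZ = prob ?R + prob ?U"
  proof -
    have "prob (?R \<union> ?U) = prob ?R + prob ?U"
      by (rule finite_measure_Union) (use RU in auto)
    moreover have "?R \<union> ?U = setZ" by auto
    ultimately show ?thesis by simp
  qed
  moreover have "prob setZ \<le> prob (via_right \<union> via_up)"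
    by (rule finite_measure_mono[OF setZ_subset_via]) (use via in auto)
  ultimately have "prob (via_right \<inter> via_up) \<le> 0" by simp
  then show ?thesis using via by (simp add: measure_le_0_iff)
qed

text \<open>
  Almost every point lies in at most one of the translates of \<open>Z\<close> along a row, and these all have the
  measure of \<open>Z\<close>.
\<close>

lemma prob_setZ: "prob setZ = 0"
proof -
  define Zs where "Zs j = {x \<in> spaceX. act (int j, - int j) x \<in> setZ}" for j :: nat
  have Z: "setZ \<in> events" by (simp add: setZ_sets sets_eq)
  have Zs: "Zs j \<in> events" "prob (Zs j) = prob setZ" for j
    unfolding Zs_def by (rule act_vimage_events[OF Z] prob_act[OF Z])+
  have bound: "real n * prob setZ \<le> 1" for n
  proof -
    have "AE x in \<mu>. \<forall>v. act v x \<notin> via_right \<inter> via_up"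
      by (rule AE_act) (use prob_via_both in auto)
    then have AE_le: "AE x in \<mu>. (\<Sum>j<n. indicator (Zs j) x) \<le> (1::real)"
      using AE_merging
    proof eventually_elim
      fix x assume nb: "\<forall>v. act v x \<notin> via_right \<inter> via_up" and x: "x \<in> merging"
      have one: "i = j" if "x \<in> Zs i" "x \<in> Zs j" for i j
      proof -
        have "(int i, - int i) = (int j, - int j)"
          by (rule setZ_sites_on_level_unique[OF x])
             (use nb that in \<open>auto simp: Zs_def level_def\<close>)
        then show ?thesis by simp
      qed
      have "(\<Sum>j<n. indicator (Zs j) x) = real (card {j \<in> {..<n}. x \<in> Zs j})"
        by (simp add: indicator_def sum.If_cases Int_def)
      also have "card {j \<in> {..<n}. x \<in> Zs j} \<le> 1"
        by (subst card_le_Suc0_iff_eq[folded One_nat_def]) (use one in auto)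
      finally show "(\<Sum>j<n. indicator (Zs j) x) \<le> (1::real)" by simp
    qed
    have "real n * prob setZ = (\<Sum>j<n. prob (Zs j))" by (simp add: Zs)
    also have "\<dots> = expectation (\<lambda>x. \<Sum>j<n. indicator (Zs j) x)"
      by (subst Bochner_Integration.integral_sum) (use Zs in \<open>simp_all add: emeasure_eq_measure Int_absorb2 sets.sets_into_space[of _ \<mu>, simplified]\<close>)
    also have "\<dots> \<le> expectation (\<lambda>x. 1)"
      by (rule integral_mono_AE) (use AE_le Zs in \<open>auto simp: emeasure_eq_measure\<close>)
    finally show ?thesis using prob_space by simp
  qed
  show ?thesis
  proof (rule ccontr)
    assume "prob setZ \<noteq> 0"
    then have "prob setZ > 0" using measure_nonneg[of \<mu> setZ] by linarith
    then obtain n :: nat where "1 < real n * prob setZ"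
      using reals_Archimedean3 by blast
    then show False using bound[of n] by simp
  qed
qed

lemma setZ_null: "setZ \<in> null_sets \<mu>"
  using prob_setZ by (simp add: null_sets_def emeasure_eq_measure setZ_sets sets_eq)

end

theorem proposition5p3:
  fixes \<mu>\<^sub>0 :: "config measure"
  assumes "haar_probability \<mu>\<^sub>0"
  shows "tree_type \<mu>\<^sub>0"
proof -
  interpret haar_measure "\<mu>\<^sub>0" using assms by (rule haar_measureI)
  have "borel_probability \<mu>\<^sub>0" using assms by (simp add: haar_probability_def)
  moreover have "\<exists>B\<in>sets borelX. invariant_set B \<and> emeasure \<mu>\<^sub>0 B = 1 \<and>
      (\<forall>x\<in>setY \<inter> B. orbit x \<inter> setY \<subseteq> sigma_component x)"
    using merging_sets invariant_merging emeasure_merging orbit_subset_sigma_component by blast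
  ultimately show ?thesis
    unfolding tree_type_def using atomless invariant_measure ergodic setZ_null by blast
qed

end
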